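(* Let $p$ be a positive even integer and $u\in\mathbb R$. For each $n\in\mathbb N$ let $A_{i_1,\dots,i_p}$, $(i_1,\dots,i_p)\in\{1,\dots,n\}^p$, be independent standard normal random variables, let $\mathbb B^n=\{\mathbf x\in\mathbb R^n:\mathbf x_i^2=\tfrac1n,\ 1\le i\le n\}$, and define $$\zeta(p;\mathbb B^n,n)=\frac{1}{\sqrt n}\max_{\mathbf x\in\mathbb B^n}\sum_{i_1,\dots,i_p=1}^nA_{i_1,\dots,i_p}\prod_{k=1}^p\mathbf x_{i_k}.$$ Suppose that the function $c_3\mapsto \frac{c_3^2}{2}+\log\Big(\operatorname{erfc}\big(-\tfrac{c_3\sqrt p}{\sqrt2}\big)\Big)-c_3u$ attains its minimum over $c_3>0$ at a point $\hat c_3>0$. Then $$\frac{1}{\operatorname{erfc}\big(-\frac{\hat c_3\sqrt p}{\sqrt2}\big)}=e^{\frac{\hat c_3^2p}{2}}(u-\hat c_3)\sqrt{\frac{\pi}{2p}},$$ and, with $$\phi_{\mathbb B^n}(p,u)=-\frac{\hat c_3^2}{2}(p-1)-\log(u-\hat c_3)-\hat c_3u-\frac12\log\Big(\frac{\pi}{2p}\Big)=\frac{\hat c_3^2}{2}+\log\Big(\operatorname{erfc}\big(-\tfrac{\hat c_3\sqrt p}{\sqrt2}\big)\Big)-\hat c_3u,$$ one has $$\lim_{n\to\infty}\frac1n\log\Big(\mathbb P\big(\zeta(p;\mathbb B^n,n)\ge u\big)\Big)\le\phi_{\mathbb B^n}(p,u).$$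
   Context: $\operatorname{erfc}(x)=\frac{2}{\sqrt\pi}\int_x^\infty e^{-t^2}\,dt$ is the complementary error function; $\mathbf x_i$ denotes the $i$-th coordinate of $\mathbf x$. *)

theory Defs
  imports "HOL-Probability.Probability"
begin

definition erfc :: "real \<Rightarrow> real" where
  "erfc x = 2 / sqrt pi * integral {x..} (\<lambda>t. exp (- (t ^ 2)))"

definition elog :: "real \<Rightarrow> ereal" where
  "elog x = (if x > 0 then ereal (ln x) else -\<infinity>)"

definition idx_set :: "nat \<Rightarrow> nat \<Rightarrow> (nat \<Rightarrow> nat) set" where
  "idx_set p n = PiE {..<p} (\<lambda>_. {..<n})"

definition Bcube :: "nat \<Rightarrow> (nat \<Rightarrow> real) set" where
  "Bcube n = {x \<in> PiE {..<n} (\<lambda>_. UNIV). \<forall>i<n. (x i)^2 = 1 / real n}"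

text \<open>zeta(p; B^n, n) for a given realisation a of the Gaussian tensor.\<close>
definition zeta :: "nat \<Rightarrow> nat \<Rightarrow> ((nat \<Rightarrow> nat) \<Rightarrow> real) \<Rightarrow> real" where
  "zeta p n a = 1 / sqrt (real n) *
     Max ((\<lambda>x. \<Sum>ii\<in>idx_set p n. a ii * (\<Prod>k<p. x (ii k))) ` Bcube n)"

end

theory Submission
  imports Defs
begin

text \<open>
  Write \<open>G x\<close> for the form on the cube, a Gaussian field with covariance \<open>(x \<bullet> y) ^ p\<close>. Since \<open>p\<close> is
  even, Bernoulli's inequality gives \<open>t ^ p + (p - 1) \<ge> p * t\<close>, with equality at \<open>t = 1\<close>. So \<open>G\<close> plus an
  independent Gaussian of variance \<open>p - 1\<close> has the same variances as the linear field
  \<open>sqrt p * (h \<bullet> x)\<close>, and larger covariances. Exponential moments of the maximum of the first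
  field are therefore bounded by those of the second, whose maximum over the cube is
  \<open>sqrt (p / n) * (\<Sum>i. \<bar>h i\<bar>)\<close>; its exponential moment factorises into Gaussian integrals that
  give \<open>erfc\<close>. Chernoff's bound at the parameter \<open>c3 * sqrt n\<close> is then the exponential rate claimed.

  The maximum is replaced by \<open>(\<Sum>x. exp (\<beta> * G x)) powr \<theta>\<close> with \<open>\<beta> * \<theta> = c3 * sqrt n\<close>, at the cost of a
  factor \<open>(2 ^ n) powr \<theta>\<close> that disappears as \<open>\<theta>\<close> tends to 0. The comparison itself is proved in the
  manner of Lindeberg: variance is exchanged between the fields in small increments, and for one
  increment the expansion of \<open>(1 + v) powr \<theta>\<close> to second order suffices.
\<close>

section \<open>Second-order Taylor estimate for real powers\<close>

text \<open>Where \<open>u \<le> - 1 / 2\<close> the cube of \<open>\<bar>u\<bar>\<close> is at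
  least 1/8, and the left side is at most 3/2; this is what fixes the constant 12. Elsewhere
  Taylor's formula at 1 applies, with a third derivative of size at most 16 on the points beyond
  1/2. There is no upper restriction on \<open>u\<close>, so the bound can be used pointwise for a
  random \<open>u\<close>.\<close>

lemma powr_taylor2:
  fixes \<theta> u :: real
  assumes th: "0 < \<theta>" "\<theta> \<le> 1" and u: "- 1 < u"
  shows "\<bar>(1 + u) powr \<theta> - (1 + \<theta> * u - \<theta> * (1 - \<theta>) / 2 * u\<^sup>2)\<bar> \<le> 12 * \<bar>u\<bar> ^ 3"
proof (cases "u \<le> - 1 / 2")
  case True
  have a: "0 \<le> (1 + u) powr \<theta>" "(1 + u) powr \<theta> \<le> 1"
    using u True th powr_mono2[of \<theta> "1 + u" 1] by auto
  have b: "0 \<le> \<theta> * (1 - \<theta>)" "\<theta> * (1 - \<theta>) \<le> 1"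
    using th by (auto intro: mult_le_one)
  have c: "0 \<le> u\<^sup>2" "u\<^sup>2 \<le> 1" using True u by (auto simp: abs_square_le_1)
  have d: "0 \<le> \<theta> * (1 - \<theta>) / 2 * u\<^sup>2" "\<theta> * (1 - \<theta>) / 2 * u\<^sup>2 \<le> 1 / 2"
    using b c mult_mono[of "\<theta> * (1 - \<theta>)" 1 "u\<^sup>2" 1] by auto
  have e: "\<theta> * u \<le> 0" "- 1 \<le> \<theta> * u"
  proof -
    show "\<theta> * u \<le> 0" using th True by (simp add: mult_le_0_iff)
    have "\<theta> * (- u) \<le> 1 * 1" using th True u by (intro mult_mono) auto
    then show "- 1 \<le> \<theta> * u" by simp
  qed
  have f: "(1 / 2) ^ 3 \<le> \<bar>u\<bar> ^ 3" using True by (intro power_mono) auto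
  have "\<bar>(1 + u) powr \<theta> - (1 + \<theta> * u - \<theta> * (1 - \<theta>) / 2 * u\<^sup>2)\<bar> \<le> 12 * (1 / 2) ^ 3"
  proof -
    have "(12::real) * (1 / 2) ^ 3 = 3 / 2" by (simp add: power3_eq_cube)
    moreover have "\<bar>(1 + u) powr \<theta> - (1 + \<theta> * u - \<theta> * (1 - \<theta>) / 2 * u\<^sup>2)\<bar> \<le> 3 / 2"
      unfolding abs_le_iff using a d e by linarith
    ultimately show ?thesis by simp
  qed
  with f show ?thesis by linarith
next
  case False
  then have u2: "u > - 1/2" by simp
  define d where "d = (\<lambda>(m::nat) (x::real). if m = 0 then x powr \<theta> else if m = 1 then \<theta> * x powr (\<theta> - 1)
    else if m = 2 then \<theta> * (\<theta> - 1) * x powr (\<theta> - 2) else \<theta> * (\<theta> - 1) * (\<theta> - 2) * x powr (\<theta> - (3::real)))"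
  show ?thesis
  proof (cases "u = 0")
    case True then show ?thesis by simp
  next
    case False
    have "\<exists>t. (if 1 + u < 1 then 1 + u < t \<and> t < 1 else 1 < t \<and> t < 1 + u) \<and>
       (\<lambda>x. x powr \<theta>) (1 + u) = (\<Sum>m<3. d m 1 / fact m * (1 + u - 1) ^ m) + d 3 t / fact 3 * (1 + u - 1) ^ 3"
    proof (rule Taylor[where a = "1/2" and b = "max 1 (1 + u)"])
      show "\<forall>m t. m < 3 \<and> 1 / 2 \<le> t \<and> t \<le> max 1 (1 + u) \<longrightarrow> (d m has_real_derivative d (Suc m) t) (at t)"
      proof (intro allI impI, elim conjE)
        fix m :: nat and t :: real assume m: "m < 3" and t: "1/2 \<le> t" 
        from m consider "m = 0" | "m = 1" | "m = 2" by linarith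
        then show "(d m has_real_derivative d (Suc m) t) (at t)"
        proof cases
          case 1 then show ?thesis using t unfolding d_def
            by (auto intro!: derivative_eq_intros)
        next
          case 2 then show ?thesis using t unfolding d_def
            by (auto intro!: derivative_eq_intros)
        next
          case 3 then show ?thesis using t unfolding d_def
            by (auto intro!: derivative_eq_intros)
        qed
      qed
    qed (use u2 False in \<open>auto simp: d_def fun_eq_iff\<close>)
    then obtain t where t: "if 1 + u < 1 then 1 + u < t \<and> t < 1 else 1 < t \<and> t < 1 + u"
      and eq: "(1 + u) powr \<theta> = (\<Sum>m<3. d m 1 / fact m * u ^ m) + d 3 t / fact 3 * u ^ 3"
      by auto
    have t2: "t \<ge> 1/2" using t u2 by (auto split: if_splits)
    have "t powr (\<theta> - 3) = inverse (t powr (3 - \<theta>))" by (simp add: powr_minus[symmetric])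
    also have "\<dots> \<le> inverse ((1/2) powr (3 - \<theta>))"
      using t2 th by (intro le_imp_inverse_le powr_mono2) auto
    also have "\<dots> \<le> inverse ((1/2) powr 3)"
      using th by (intro le_imp_inverse_le powr_mono') auto
    also have "\<dots> = 8" by (simp add: powr_numeral power3_eq_cube)
    finally have 8: "t powr (\<theta> - 3) \<le> 8" .
    have "\<bar>\<theta> * (\<theta> - 1) * (\<theta> - 2)\<bar> \<le> 1 * 1 * 2"
      unfolding abs_mult using th by (intro mult_mono) auto
    then have "\<bar>\<theta> * (\<theta> - 1) * (\<theta> - 2)\<bar> * t powr (\<theta> - 3) \<le> 2 * 8"
      using 8 by (intro mult_mono) auto
    then have "\<bar>d 3 t\<bar> \<le> 2 * 8" by (simp add: d_def abs_mult)
    then have dt: "\<bar>d 3 t / fact 3\<bar> \<le> 12" by (simp add: fact_numeral)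
    have "(\<Sum>m<3. d m 1 / fact m * u ^ m) = 1 + \<theta> * u - \<theta> * (1 - \<theta>) / 2 * u\<^sup>2"
      by (simp add: d_def numeral_3_eq_3 lessThan_Suc field_simps power2_eq_square)
    then have "\<bar>(1 + u) powr \<theta> - (1 + \<theta> * u - \<theta> * (1 - \<theta>) / 2 * u\<^sup>2)\<bar> = \<bar>d 3 t / fact 3\<bar> * \<bar>u\<bar> ^ 3"
      using eq by (simp add: abs_mult power_abs)
    also have "\<dots> \<le> 12 * \<bar>u\<bar> ^ 3" using dt by (intro mult_right_mono) auto
    finally show ?thesis .
  qed
qed

section \<open>The standard Gaussian measure\<close>

definition gauss :: "real measure" where
  "gauss = density lborel (\<lambda>x. ennreal (std_normal_density x))"

lemma sets_gauss [simp, measurable_cong]: "sets gauss = sets borel"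
  by (simp add: gauss_def)

lemma space_gauss [simp]: "space gauss = UNIV"
  by (simp add: gauss_def)

lemma prob_space_gauss: "prob_space gauss"
  unfolding gauss_def by (rule prob_space_normal_density) simp

lemma nn_integral_gauss:
  assumes [measurable]: "f \<in> borel_measurable borel"
  shows "(\<integral>\<^sup>+x. f x \<partial>gauss) = (\<integral>\<^sup>+x. ennreal (std_normal_density x) * f x \<partial>lborel)"
  unfolding gauss_def by (subst nn_integral_density) auto

lemma nn_integral_exp_gauss: "(\<integral>\<^sup>+x. ennreal (exp (c * x)) \<partial>gauss) = ennreal (exp (c\<^sup>2 / 2))"
proof -
  have "(\<integral>\<^sup>+x. ennreal (exp (c * x)) \<partial>gauss)
    = (\<integral>\<^sup>+x. ennreal (exp (c\<^sup>2 / 2)) * ennreal (normal_density c 1 x) \<partial>lborel)"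
  proof (subst nn_integral_gauss, simp, intro nn_integral_cong)
    fix x :: real
    \<comment> \<open>Completing the square: exponential tilting by \<open>c\<close> shifts the mean
      to \<open>c\<close>.\<close>
    have "std_normal_density x * exp (c * x) = exp (c\<^sup>2 / 2) * normal_density c 1 x"
      by (simp add: normal_density_def mult_exp_exp power2_eq_square field_simps)
    then show "ennreal (std_normal_density x) * ennreal (exp (c * x))
      = ennreal (exp (c\<^sup>2 / 2)) * ennreal (normal_density c 1 x)"
      by (simp flip: ennreal_mult)
  qed
  also have "\<dots> = ennreal (exp (c\<^sup>2 / 2))"
    by (subst nn_integral_cmult) (simp_all add: nn_integral_eq_integral)
  finally show ?thesis .
qed

text \<open>The law of \<open>a * x + b * y\<close> is the convolution of centred normal laws with
  deviations \<open>a\<close> and \<open>b\<close>, hence standard normal. The convolution formula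
  needs positive deviations, so a vanishing coefficient is treated apart.\<close>

lemma gauss_rotate:
  fixes a b :: real
  assumes [measurable]: "f \<in> borel_measurable borel" and ab: "0 \<le> a" "0 \<le> b" "a\<^sup>2 + b\<^sup>2 = 1"
  shows "(\<integral>\<^sup>+x. f x \<partial>gauss) = (\<integral>\<^sup>+x. \<integral>\<^sup>+y. f (a * x + b * y) \<partial>gauss \<partial>gauss)"
proof -
  interpret prob_space gauss by (rule prob_space_gauss)
  consider "a = 0" | "b = 0" | "0 < a" "0 < b" using ab by linarith
  then show ?thesis
  proof cases
    case 1
    then have "b = 1" using ab by (simp add: power2_eq_1_iff)
    with 1 show ?thesis using emeasure_space_1 by simp
  next
    case 2
    then have "a = 1" using ab by (simp add: power2_eq_1_iff)
    with 2 show ?thesis using emeasure_space_1 by simp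
  next
    case 3
    let ?\<phi> = "\<lambda>x. ennreal (std_normal_density x)"
    have scale: "normal_density 0 s (s * x) * s = std_normal_density x" if "s > 0" for s x :: real
      using that by (simp add: normal_density_def real_sqrt_mult power_mult_distrib)
    have "(\<integral>\<^sup>+x. \<integral>\<^sup>+y. f (a * x + b * y) \<partial>gauss \<partial>gauss)
      = (\<integral>\<^sup>+x. ?\<phi> x * (\<integral>\<^sup>+y. ?\<phi> y * f (a * x + b * y) \<partial>lborel) \<partial>lborel)"
      by (simp add: nn_integral_gauss)
    also have "\<dots> = (\<integral>\<^sup>+x. \<integral>\<^sup>+y. ?\<phi> x * ?\<phi> y * f (a * x + b * y) \<partial>lborel \<partial>lborel)"
      by (simp add: nn_integral_cmult[symmetric] mult.assoc)
    also have "\<dots> = (\<integral>\<^sup>+y. \<integral>\<^sup>+x. ?\<phi> x * ?\<phi> y * f (a * x + b * y) \<partial>lborel \<partial>lborel)"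
      by (rule lborel_pair.Fubini'[symmetric]) simp
    \<comment> \<open>Substitution \<open>z = a * x + b * y\<close> for fixed \<open>y\<close>;
      after the next exchange of integrals, the integral over \<open>y\<close> is a convolution
      evaluated at \<open>z\<close>.\<close>
    also have "\<dots> = (\<integral>\<^sup>+y. \<integral>\<^sup>+z. ennreal (normal_density 0 a (z - b * y)) * ?\<phi> y * f z \<partial>lborel \<partial>lborel)"
    proof (rule nn_integral_cong)
      fix y :: real
      show "(\<integral>\<^sup>+x. ?\<phi> x * ?\<phi> y * f (a * x + b * y) \<partial>lborel)
        = (\<integral>\<^sup>+z. ennreal (normal_density 0 a (z - b * y)) * ?\<phi> y * f z \<partial>lborel)"
      proof -
        have "(\<integral>\<^sup>+z. ennreal (normal_density 0 a (z - b * y)) * ?\<phi> y * f z \<partial>lborel)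
          = ennreal \<bar>a\<bar> * (\<integral>\<^sup>+x. ennreal (normal_density 0 a (b * y + a * x - b * y)) * ?\<phi> y * f (b * y + a * x) \<partial>lborel)"
          using 3 by (intro nn_integral_real_affine) simp_all
        also have "\<dots> = (\<integral>\<^sup>+x. ?\<phi> x * ?\<phi> y * f (a * x + b * y) \<partial>lborel)"
          using 3 by (simp add: nn_integral_cmult[symmetric] scale[of a, symmetric] ennreal_mult mult_ac add.commute)
        finally show ?thesis by simp
      qed
    qed
    also have "\<dots> = (\<integral>\<^sup>+z. \<integral>\<^sup>+y. ennreal (normal_density 0 a (z - b * y)) * ?\<phi> y * f z \<partial>lborel \<partial>lborel)"
      by (rule lborel_pair.Fubini'[symmetric]) simp
    also have "\<dots> = (\<integral>\<^sup>+z. ?\<phi> z * f z \<partial>lborel)"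
    proof (rule nn_integral_cong)
      fix z :: real
      have "(\<integral>\<^sup>+y. ennreal (normal_density 0 a (z - b * y)) * ?\<phi> y * f z \<partial>lborel)
        = (\<integral>\<^sup>+y. ennreal (normal_density 0 a (z - b * y)) * ?\<phi> y \<partial>lborel) * f z"
        by (rule nn_integral_multc) simp
      also have "(\<integral>\<^sup>+y. ennreal (normal_density 0 a (z - b * y)) * ?\<phi> y \<partial>lborel)
        = (\<integral>\<^sup>+w. ennreal (normal_density 0 a (z - w) * normal_density 0 b w) \<partial>lborel)"
      proof -
        have "(\<integral>\<^sup>+w. ennreal (normal_density 0 a (z - w) * normal_density 0 b w) \<partial>lborel)
          = ennreal \<bar>b\<bar> * (\<integral>\<^sup>+y. ennreal (normal_density 0 a (z - (0 + b * y)) * normal_density 0 b (0 + b * y)) \<partial>lborel)"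
          using 3 by (intro nn_integral_real_affine) simp_all
        also have "\<dots> = (\<integral>\<^sup>+y. ennreal (normal_density 0 a (z - b * y)) * ?\<phi> y \<partial>lborel)"
          using 3 by (simp add: nn_integral_cmult[symmetric] scale[of b, symmetric] ennreal_mult mult_ac)
        finally show ?thesis by simp
      qed
      also have "\<dots> = ?\<phi> z"
        using fun_cong[OF conv_normal_density_zero_mean[OF 3], of z] ab by simp
      finally show "(\<integral>\<^sup>+y. ennreal (normal_density 0 a (z - b * y)) * ?\<phi> y * f z \<partial>lborel) = ?\<phi> z * f z" .
    qed
    finally show ?thesis by (simp add: nn_integral_gauss)
  qed
qed

section \<open>Standard Gaussian vectors\<close>

definition gauss_vec :: "'i set \<Rightarrow> ('i \<Rightarrow> real) measure" where
  "gauss_vec I = PiM I (\<lambda>_. gauss)"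

interpretation gauss: prob_space gauss
  by (rule prob_space_gauss)

interpretation gauss_prod: product_prob_space "\<lambda>_. gauss" I for I
  by unfold_locales

lemma borel_measurable_gauss: "f \<in> borel_measurable borel \<Longrightarrow> f \<in> borel_measurable gauss"
  by (simp cong: measurable_cong_sets)

lemma prob_space_gauss_vec: "prob_space (gauss_vec I)"
  unfolding gauss_vec_def by (rule prob_space_PiM) (rule prob_space_gauss)

interpretation gauss_vec: prob_space "gauss_vec I" for I
  by (rule prob_space_gauss_vec)

lemma measurable_gauss_vec_component [measurable]:
  "i \<in> I \<Longrightarrow> (\<lambda>g. g i) \<in> borel_measurable (gauss_vec I)"
  unfolding gauss_vec_def by measurable

lemma borel_measurable_linear_gauss_vec [measurable]:
  fixes c :: "'i \<Rightarrow> real"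
  shows "(\<lambda>g. \<Sum>i\<in>I. c i * g i) \<in> borel_measurable (gauss_vec I)"
  by measurable

lemma nn_integral_exp_gauss_vec:
  assumes "finite I"
  shows "(\<integral>\<^sup>+g. ennreal (exp (\<Sum>i\<in>I. c i * g i)) \<partial>gauss_vec I) = ennreal (exp ((\<Sum>i\<in>I. (c i)\<^sup>2) / 2))"
proof -
  have "(\<integral>\<^sup>+g. ennreal (exp (\<Sum>i\<in>I. c i * g i)) \<partial>gauss_vec I)
    = (\<integral>\<^sup>+g. (\<Prod>i\<in>I. ennreal (exp (c i * g i))) \<partial>gauss_vec I)"
    using assms by (simp add: exp_sum prod_ennreal)
  also have "\<dots> = (\<Prod>i\<in>I. ennreal (exp ((c i)\<^sup>2 / 2)))"
    unfolding gauss_vec_def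
    by (subst gauss_prod.product_nn_integral_prod[OF assms])
       (auto intro: borel_measurable_gauss simp: nn_integral_exp_gauss)
  also have "\<dots> = ennreal (exp ((\<Sum>i\<in>I. (c i)\<^sup>2) / 2))"
    using assms by (simp add: exp_sum prod_ennreal sum_divide_distrib)
  finally show ?thesis .
qed

lemma has_bochner_integral_exp_gauss_vec:
  assumes "finite I"
  shows "has_bochner_integral (gauss_vec I) (\<lambda>g. exp (\<Sum>i\<in>I. c i * g i)) (exp ((\<Sum>i\<in>I. (c i)\<^sup>2) / 2))"
  using nn_integral_exp_gauss_vec[OF assms, of c]
  by (intro has_bochner_integral_nn_integral) simp_all

text \<open>Induction on the coordinates: \<open>gauss_rotate\<close> splits the new coordinate, the
  induction hypothesis the others.\<close>

lemma gauss_vec_rotate: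
  fixes a b :: real and f :: "('i \<Rightarrow> real) \<Rightarrow> ennreal"
  assumes "finite I" "f \<in> borel_measurable (gauss_vec I)"
    and ab: "0 \<le> a" "0 \<le> b" "a\<^sup>2 + b\<^sup>2 = 1"
  shows "(\<integral>\<^sup>+g. f g \<partial>gauss_vec I)
    = (\<integral>\<^sup>+g. \<integral>\<^sup>+h. f (\<lambda>i\<in>I. a * g i + b * h i) \<partial>gauss_vec I \<partial>gauss_vec I)"
  using assms(1,2)
proof (induction I arbitrary: f rule: finite_induct)
  case empty
  have 0: "space (gauss_vec {}) = {\<lambda>x. undefined}" by (simp add: gauss_vec_def space_PiM)
  have "(\<integral>\<^sup>+g. \<integral>\<^sup>+h. f (\<lambda>i\<in>{}. a * g i + b * h i) \<partial>gauss_vec {} \<partial>gauss_vec {}) = f (\<lambda>x. undefined)"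
    by (simp add: gauss_vec.emeasure_space_1 restrict_def)
  moreover have "(\<integral>\<^sup>+g. f g \<partial>gauss_vec {}) = (\<integral>\<^sup>+g. f (\<lambda>x. undefined) \<partial>gauss_vec ({}::'i set))"
    by (rule nn_integral_cong) (simp add: 0)
  ultimately show ?case by (simp add: gauss_vec.emeasure_space_1)
next
  case (insert i I)
  note [measurable] = insert.prems[unfolded gauss_vec_def]
  note I = insert.hyps(1,2)
  have [measurable]: "(\<lambda>x. \<lambda>j\<in>I. a * fst x j + b * snd x j)
      \<in> gauss_vec I \<Otimes>\<^sub>M gauss_vec I \<rightarrow>\<^sub>M PiM I (\<lambda>_. gauss)"
    unfolding gauss_vec_def by measurable
  have upd: "(\<lambda>j\<in>insert i I. a * (g(i := y)) j + b * (h(i := z)) j)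
      = (\<lambda>j\<in>I. a * g j + b * h j)(i := a * y + b * z)" for g h y z
    using I by (auto simp: fun_eq_iff)
  have pair: "pair_sigma_finite gauss (gauss_vec I)" 
    by unfold_locales
  have upd_m [measurable]: "(\<lambda>(g, y). f (g(i := y))) \<in> borel_measurable (PiM I (\<lambda>_. gauss) \<Otimes>\<^sub>M gauss)"
    by measurable
  have "(\<integral>\<^sup>+g. f g \<partial>gauss_vec (insert i I)) = (\<integral>\<^sup>+g. \<integral>\<^sup>+y. f (g(i := y)) \<partial>gauss \<partial>gauss_vec I)"
    unfolding gauss_vec_def using I by (intro gauss_prod.product_nn_integral_insert) auto
  also have "\<dots> = (\<integral>\<^sup>+g. \<integral>\<^sup>+y. \<integral>\<^sup>+z. f (g(i := a * y + b * z)) \<partial>gauss \<partial>gauss \<partial>gauss_vec I)"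
    using ab I by (intro nn_integral_cong gauss_rotate) (auto simp: gauss_vec_def)
  also have "\<dots> = (\<integral>\<^sup>+g. \<integral>\<^sup>+h. \<integral>\<^sup>+y. \<integral>\<^sup>+z. f ((\<lambda>j\<in>I. a * g j + b * h j)(i := a * y + b * z))
      \<partial>gauss \<partial>gauss \<partial>gauss_vec I \<partial>gauss_vec I)"
    unfolding gauss_vec_def by (intro insert.IH[unfolded gauss_vec_def]) measurable
  \<comment> \<open>With \<open>y\<close> moved outside \<open>h\<close>, the pairs
    \<open>(g, y)\<close> and \<open>(h, z)\<close> can each be reassembled into a vector over
    \<open>insert i I\<close>.\<close>
  also have "\<dots> = (\<integral>\<^sup>+g. \<integral>\<^sup>+y. \<integral>\<^sup>+h. \<integral>\<^sup>+z. f ((\<lambda>j\<in>I. a * g j + b * h j)(i := a * y + b * z))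
      \<partial>gauss \<partial>gauss_vec I \<partial>gauss \<partial>gauss_vec I)"
  proof (rule nn_integral_cong)
    fix g assume g: "g \<in> space (gauss_vec I)"
    then have [measurable]: "(\<lambda>h. \<lambda>j\<in>I. a * g j + b * h j) \<in> gauss_vec I \<rightarrow>\<^sub>M PiM I (\<lambda>_. gauss)"
      unfolding gauss_vec_def by measurable
    show "(\<integral>\<^sup>+h. \<integral>\<^sup>+y. \<integral>\<^sup>+z. f ((\<lambda>j\<in>I. a * g j + b * h j)(i := a * y + b * z)) \<partial>gauss \<partial>gauss \<partial>gauss_vec I)
      = (\<integral>\<^sup>+y. \<integral>\<^sup>+h. \<integral>\<^sup>+z. f ((\<lambda>j\<in>I. a * g j + b * h j)(i := a * y + b * z)) \<partial>gauss \<partial>gauss_vec I \<partial>gauss)"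
      by (rule pair_sigma_finite.Fubini'[OF pair]) measurable
  qed
  also have "\<dots> = (\<integral>\<^sup>+g. \<integral>\<^sup>+y. \<integral>\<^sup>+h. \<integral>\<^sup>+z. f (\<lambda>j\<in>insert i I. a * (g(i := y)) j + b * (h(i := z)) j)
      \<partial>gauss \<partial>gauss_vec I \<partial>gauss \<partial>gauss_vec I)"
    by (simp only: upd)
  also have "\<dots> = (\<integral>\<^sup>+g. \<integral>\<^sup>+y. \<integral>\<^sup>+h. f (\<lambda>j\<in>insert i I. a * (g(i := y)) j + b * h j)
      \<partial>gauss_vec (insert i I) \<partial>gauss \<partial>gauss_vec I)"
  proof (intro nn_integral_cong)
    fix g y
    show "(\<integral>\<^sup>+h. \<integral>\<^sup>+z. f (\<lambda>j\<in>insert i I. a * (g(i := y)) j + b * (h(i := z)) j) \<partial>gauss \<partial>gauss_vec I)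
      = (\<integral>\<^sup>+h. f (\<lambda>j\<in>insert i I. a * (g(i := y)) j + b * h j) \<partial>gauss_vec (insert i I))"
      unfolding gauss_vec_def using I
      by (intro gauss_prod.product_nn_integral_insert[symmetric]) auto
  qed
  also have "\<dots> = (\<integral>\<^sup>+g. \<integral>\<^sup>+h. f (\<lambda>j\<in>insert i I. a * g j + b * h j)
      \<partial>gauss_vec (insert i I) \<partial>gauss_vec (insert i I))"
    unfolding gauss_vec_def using I
    by (intro gauss_prod.product_nn_integral_insert[symmetric]) auto
  finally show ?case .
qed

section \<open>A second-order expansion of moments of exponential mixtures\<close>

text \<open>Isolates the factor \<open>s ^ 3\<close> and leaves a function of \<open>x\<close> whose
  Gaussian mean is explicit. It combines \<open>\<bar>exp y - 1\<bar> \<le> \<bar>y\<bar> * exp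
  \<bar>y\<bar>\<close> with \<open>\<bar>x\<bar> ^ 3 \<le> 27 * exp \<bar>x\<bar>\<close>.\<close>

lemma abs_exp_diff_one_cube_le:
  fixes s x :: real
  assumes "0 \<le> s" "s \<le> 1"
  shows "\<bar>exp (s * x) - 1\<bar> ^ 3 \<le> 27 * s ^ 3 * (exp (4 * x) + exp (- 4 * x))"
proof -
  have "\<bar>exp y - 1\<bar> \<le> \<bar>y\<bar> * exp \<bar>y\<bar>" for y :: real
  proof (cases "0 \<le> y")
    case True
    have "(1 - y) * exp y \<le> exp (- y) * exp y"
      using exp_ge_add_one_self[of "- y"] by (intro mult_right_mono) auto
    also have "\<dots> = 1" by (simp flip: exp_add)
    finally show ?thesis using True by (simp add: algebra_simps)
  next
    case False
    then have "1 - exp y \<le> - y" using exp_ge_add_one_self[of y] by linarith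
    also have "\<dots> \<le> - y * exp (- y)" using False by (simp add: mult_le_cancel_left1)
    finally show ?thesis using False by simp
  qed
  from this[of "s * x"] have "\<bar>exp (s * x) - 1\<bar> \<le> s * \<bar>x\<bar> * exp (s * \<bar>x\<bar>)"
    using assms by (simp add: abs_mult)
  also have "\<dots> \<le> s * \<bar>x\<bar> * exp \<bar>x\<bar>"
    using assms by (intro mult_left_mono) (auto simp: mult_left_le_one_le)
  finally have "\<bar>exp (s * x) - 1\<bar> ^ 3 \<le> (s * \<bar>x\<bar> * exp \<bar>x\<bar>) ^ 3"
    by (intro power_mono) auto
  also have "\<dots> = s ^ 3 * \<bar>x\<bar> ^ 3 * exp (3 * \<bar>x\<bar>)"
    by (simp add: power_mult_distrib flip: exp_of_nat_mult)
  also have "\<dots> \<le> s ^ 3 * (27 * exp \<bar>x\<bar>) * exp (3 * \<bar>x\<bar>)"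
  proof -
    have "(\<bar>x\<bar> / 3) ^ 3 \<le> (1 + \<bar>x\<bar> / real 3) ^ 3" by (intro power_mono) auto
    also have "\<dots> \<le> exp \<bar>x\<bar>" by (rule exp_ge_one_plus_x_over_n_power_n) auto
    finally have "\<bar>x\<bar> ^ 3 \<le> 27 * exp \<bar>x\<bar>" by (simp add: power_divide)
    then show ?thesis using assms by (intro mult_right_mono mult_left_mono) auto
  qed
  also have "\<dots> = 27 * s ^ 3 * exp (4 * \<bar>x\<bar>)"
    by (simp add: mult_exp_exp)
  also have "\<dots> \<le> 27 * s ^ 3 * (exp (4 * x) + exp (- 4 * x))"
    using assms by (intro mult_left_mono) (auto simp: abs_if)
  finally show ?thesis .
qed

text \<open>The coefficient \<open>m1\<close> depends on the variances only, and \<open>m2\<close>, which enters with a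
  nonpositive factor, is monotone in the covariances: this is what drives the comparison.\<close>

lemma powr_exp_mean_expansion:
  fixes X :: "'x \<Rightarrow> 'a \<Rightarrow> real" and w :: "'x \<Rightarrow> real" and C :: "'x \<Rightarrow> 'x \<Rightarrow> real"
  assumes P: "prob_space P" and T: "finite T"
    and w: "\<And>x. x \<in> T \<Longrightarrow> 0 \<le> w x" "sum w T = 1"
    and X: "\<And>x. x \<in> T \<Longrightarrow> X x \<in> borel_measurable P"
    and mgf: "\<And>x y r s. x \<in> T \<Longrightarrow> y \<in> T \<Longrightarrow>
      has_bochner_integral P (\<lambda>\<omega>. exp (r * X x \<omega> + s * X y \<omega>))
        (exp ((r\<^sup>2 * C x x + s\<^sup>2 * C y y + 2 * r * s * C x y) / 2))"
    and V: "\<And>x. x \<in> T \<Longrightarrow> C x x \<le> V"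
    and s: "0 \<le> s" "s \<le> 1" and th: "0 < \<theta>" "\<theta> \<le> 1"
  defines "R \<equiv> \<lambda>\<omega>. \<Sum>x\<in>T. w x * exp (s * X x \<omega>)"
  defines "m1 \<equiv> \<Sum>x\<in>T. w x * (exp (s\<^sup>2 * C x x / 2) - 1)"
  defines "m2 \<equiv> \<Sum>x\<in>T. \<Sum>y\<in>T. w x * w y * (exp (s\<^sup>2 * (C x x + C y y + 2 * C x y) / 2)
    - exp (s\<^sup>2 * C x x / 2) - exp (s\<^sup>2 * C y y / 2) + 1)"
  shows "integrable P (\<lambda>\<omega>. R \<omega> powr \<theta>)"
    and "\<bar>(\<integral>\<omega>. R \<omega> powr \<theta> \<partial>P) - (1 + \<theta> * m1 - \<theta> * (1 - \<theta>) / 2 * m2)\<bar> \<le> 648 * exp (8 * V) * s ^ 3"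
proof -
  interpret prob_space P by fact
  note X[measurable]
  \<comment> \<open>Since the weights sum to 1, \<open>R\<close> is \<open>1 + u\<close> with
    \<open>u > -1\<close>, as \<open>powr_taylor2\<close> requires.\<close>
  define u where "u = (\<lambda>\<omega>. \<Sum>x\<in>T. w x * (exp (s * X x \<omega>) - 1))"
  have Ru: "R \<omega> = 1 + u \<omega>" for \<omega>
    using w(2) by (simp add: R_def u_def right_diff_distrib sum_subtractf)
  obtain z where z: "z \<in> T" "0 < w z"
    using w by (metis less_eq_real_def sum.neutral zero_neq_one)
  have R_pos: "0 < R \<omega>" for \<omega>
    unfolding R_def using T z w by (intro sum_pos2[of T z]) auto
  have E: "has_bochner_integral P (\<lambda>\<omega>. exp (r * X x \<omega>)) (exp (r\<^sup>2 * C x x / 2))" if "x \<in> T" for x r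
    using mgf[OF that that, of r 0] by simp
  have h1: "has_bochner_integral P u m1"
    unfolding u_def m1_def
    by (intro has_bochner_integral_sum has_bochner_integral_mult_right has_bochner_integral_diff E)
       (simp_all add: has_bochner_integral_iff prob_space)
  have h2: "has_bochner_integral P (\<lambda>\<omega>. (u \<omega>)\<^sup>2) m2"
  proof -
    have "has_bochner_integral P (\<lambda>\<omega>. exp (s * X x \<omega> + s * X y \<omega>) - exp (s * X x \<omega>) - exp (s * X y \<omega>) + 1)
       (exp (s\<^sup>2 * (C x x + C y y + 2 * C x y) / 2)
    - exp (s\<^sup>2 * C x x / 2) - exp (s\<^sup>2 * C y y / 2) + 1)" if "x \<in> T" "y \<in> T" for x y
    proof -
      have "s\<^sup>2 * (C x x + C y y + 2 * C x y) = s\<^sup>2 * C x x + s\<^sup>2 * C y y + 2 * s * s * C x y"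
        by (simp add: power2_eq_square algebra_simps)
      then show ?thesis
        using that mgf[OF that, of s s]
        by (intro has_bochner_integral_add has_bochner_integral_diff E)
           (simp_all add: has_bochner_integral_iff prob_space)
    qed
    then have "has_bochner_integral P (\<lambda>\<omega>. \<Sum>x\<in>T. \<Sum>y\<in>T. w x * w y *
        (exp (s * X x \<omega> + s * X y \<omega>) - exp (s * X x \<omega>) - exp (s * X y \<omega>) + 1)) m2"
      unfolding m2_def
      by (intro has_bochner_integral_sum has_bochner_integral_mult_right) auto
    also have "(\<lambda>\<omega>. \<Sum>x\<in>T. \<Sum>y\<in>T. w x * w y *
        (exp (s * X x \<omega> + s * X y \<omega>) - exp (s * X x \<omega>) - exp (s * X y \<omega>) + 1)) = (\<lambda>\<omega>. (u \<omega>)\<^sup>2)"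
      unfolding u_def power2_eq_square sum_product
      by (intro ext sum.cong) (auto simp: exp_add algebra_simps)
    finally show ?thesis .
  qed
  \<comment> \<open>An integrable majorant of the cubic remainder, obtained from Jensen's inequality
    for the cube and \<open>abs_exp_diff_one_cube_le\<close>.\<close>
  define B where "B = (\<lambda>\<omega>. \<Sum>x\<in>T. w x * (27 * s ^ 3 * (exp (4 * X x \<omega>) + exp (- 4 * X x \<omega>))))"
  have hB: "has_bochner_integral P B (\<Sum>x\<in>T. w x * (27 * s ^ 3 * (exp (8 * C x x) + exp (8 * C x x))))"
    unfolding B_def using E[of _ 4] E[of _ "-4"]
    by (intro has_bochner_integral_sum has_bochner_integral_mult_right has_bochner_integral_add) auto
  have u3: "\<bar>u \<omega>\<bar> ^ 3 \<le> B \<omega>" for \<omega>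
  proof -
    have "\<bar>u \<omega>\<bar> \<le> (\<Sum>x\<in>T. w x * \<bar>exp (s * X x \<omega>) - 1\<bar>)"
      unfolding u_def using w by (intro order_trans[OF sum_abs] sum_mono) (simp add: abs_mult)
    then have "\<bar>u \<omega>\<bar> ^ 3 \<le> (\<Sum>x\<in>T. w x * \<bar>exp (s * X x \<omega>) - 1\<bar>) ^ 3"
      by (intro power_mono) auto
    also have "\<dots> \<le> (\<Sum>x\<in>T. w x * \<bar>exp (s * X x \<omega>) - 1\<bar> ^ 3)"
      using convex_on_sum[OF T _ convex_power_odd[of 3], of w "\<lambda>x. \<bar>exp (s * X x \<omega>) - 1\<bar>"] w z
      by auto
    also have "\<dots> \<le> B \<omega>"
      unfolding B_def using w abs_exp_diff_one_cube_le[OF s]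
      by (intro sum_mono mult_left_mono) auto
    finally show ?thesis .
  qed
  \<comment> \<open>The exponents 4 and -4 both have mean \<open>exp (16 * C x x / 2)\<close>, and
    54 is twice 27. The Taylor constant 12 then gives 648.\<close>
  have EB: "(\<integral>\<omega>. B \<omega> \<partial>P) \<le> 54 * s ^ 3 * exp (8 * V)"
  proof -
    have "(\<integral>\<omega>. B \<omega> \<partial>P) \<le> (\<Sum>x\<in>T. w x * (54 * s ^ 3 * exp (8 * V)))"
      unfolding has_bochner_integral_integral_eq[OF hB] using V w s
      by (intro sum_mono mult_left_mono) (auto intro!: mult_left_mono)
    then show ?thesis using w by (simp flip: sum_distrib_right)
  qed
  have i3: "integrable P B" using hB by (simp add: has_bochner_integral_iff)
  define Q where "Q = (\<lambda>\<omega>. 1 + \<theta> * u \<omega> - \<theta> * (1 - \<theta>) / 2 * (u \<omega>)\<^sup>2)"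
  have hQ: "has_bochner_integral P Q (1 + \<theta> * m1 - \<theta> * (1 - \<theta>) / 2 * m2)"
    unfolding Q_def using h1 h2
    by (intro has_bochner_integral_add has_bochner_integral_diff has_bochner_integral_mult_right)
       (simp_all add: has_bochner_integral_iff prob_space)
  have D: "\<bar>R \<omega> powr \<theta> - Q \<omega>\<bar> \<le> 12 * B \<omega>" for \<omega>
    using powr_taylor2[OF th, of "u \<omega>"] R_pos[of \<omega>] u3[of \<omega>] unfolding Ru Q_def by force
  have mR: "R \<in> borel_measurable P" unfolding R_def by measurable
  have iQ: "integrable P Q" using hQ by (simp add: has_bochner_integral_iff)
  have mQ: "Q \<in> borel_measurable P" by (rule borel_measurable_integrable[OF iQ])
  have iD: "integrable P (\<lambda>\<omega>. R \<omega> powr \<theta> - Q \<omega>)"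
  proof (rule Bochner_Integration.integrable_bound[of P "\<lambda>\<omega>. 12 * B \<omega>"])
    show "integrable P (\<lambda>\<omega>. 12 * B \<omega>)" using i3 by simp
    show "AE \<omega> in P. norm (R \<omega> powr \<theta> - Q \<omega>) \<le> norm (12 * B \<omega>)"
      unfolding real_norm_def by (intro AE_I2 order_trans[OF D abs_ge_self])
  qed (intro borel_measurable_diff powr_real_measurable mR mQ borel_measurable_const)
  show int: "integrable P (\<lambda>\<omega>. R \<omega> powr \<theta>)"
    using Bochner_Integration.integrable_add[OF iD iQ] by simp
  have "\<bar>(\<integral>\<omega>. R \<omega> powr \<theta> \<partial>P) - (\<integral>\<omega>. Q \<omega> \<partial>P)\<bar> = \<bar>\<integral>\<omega>. R \<omega> powr \<theta> - Q \<omega> \<partial>P\<bar>"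
    using int iQ by simp
  also have "\<dots> \<le> (\<integral>\<omega>. \<bar>R \<omega> powr \<theta> - Q \<omega>\<bar> \<partial>P)" by (rule integral_abs_bound)
  also have "\<dots> \<le> (\<integral>\<omega>. 12 * B \<omega> \<partial>P)"
    using iD i3 D by (intro integral_mono) auto
  also have "\<dots> \<le> 648 * exp (8 * V) * s ^ 3" using EB by simp
  finally show "\<bar>(\<integral>\<omega>. R \<omega> powr \<theta> \<partial>P) - (1 + \<theta> * m1 - \<theta> * (1 - \<theta>) / 2 * m2)\<bar> \<le> 648 * exp (8 * V) * s ^ 3"
    unfolding has_bochner_integral_integral_eq[OF hQ] .
qed

section \<open>One exchange step between two Gaussian fields\<close>

text \<open>Has the shape of the hypothesis \<open>mgf\<close> of
  \<open>powr_exp_mean_expansion\<close>, the covariances being inner products of coefficient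
  vectors.\<close>

lemma has_bochner_integral_exp_gauss_vec_pair:
  assumes "finite I"
  shows "has_bochner_integral (gauss_vec I)
    (\<lambda>g. exp (r * (\<Sum>i\<in>I. a i * g i) + s * (\<Sum>i\<in>I. b i * g i)))
    (exp ((r\<^sup>2 * (\<Sum>i\<in>I. a i * a i) + s\<^sup>2 * (\<Sum>i\<in>I. b i * b i) + 2 * r * s * (\<Sum>i\<in>I. a i * b i)) / 2))"
proof -
  have 1: "r * (\<Sum>i\<in>I. a i * g i) + s * (\<Sum>i\<in>I. b i * g i) = (\<Sum>i\<in>I. (r * a i + s * b i) * g i)" for g
    by (simp add: sum_distrib_left sum.distrib[symmetric] algebra_simps)
  have 2: "r\<^sup>2 * (\<Sum>i\<in>I. a i * a i) + s\<^sup>2 * (\<Sum>i\<in>I. b i * b i) + 2 * r * s * (\<Sum>i\<in>I. a i * b i)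
      = (\<Sum>i\<in>I. (r * a i + s * b i)\<^sup>2)"
    by (simp add: sum_distrib_left sum.distrib[symmetric] algebra_simps power2_eq_square)
  show ?thesis unfolding 1 2 by (rule has_bochner_integral_exp_gauss_vec[OF assms])
qed

text \<open>By convexity of \<open>exp\<close> the weighted mean dominates the exponential of one
  centred Gaussian, and the mean of that is at least 1. This turns an additive error into a
  multiplicative one.\<close>

lemma gauss_vec_powr_lower_bound:
  assumes "finite I" "finite T" "T \<noteq> {}" and w: "\<And>x. x \<in> T \<Longrightarrow> 0 \<le> w x" "sum w T = 1" and "0 \<le> \<theta>"
    and int: "integrable (gauss_vec I) (\<lambda>g. (\<Sum>x\<in>T. w x * exp (s * (\<Sum>i\<in>I. a x i * g i))) powr \<theta>)"
  shows "1 \<le> (\<integral>g. (\<Sum>x\<in>T. w x * exp (s * (\<Sum>i\<in>I. a x i * g i))) powr \<theta> \<partial>gauss_vec I)"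
proof -
  let ?c = "\<lambda>i. \<Sum>x\<in>T. \<theta> * (w x * (s * a x i))"
  have eq: "\<theta> * (\<Sum>x\<in>T. w x * (s * (\<Sum>i\<in>I. a x i * g i))) = (\<Sum>i\<in>I. ?c i * g i)" for g
    by (simp add: sum_distrib_left sum_distrib_right mult.assoc) (rule sum.swap)
  note h = has_bochner_integral_exp_gauss_vec[OF assms(1), of ?c]
  have "1 \<le> exp ((\<Sum>i\<in>I. (?c i)\<^sup>2) / 2)"
    by (simp add: sum_nonneg)
  also have "\<dots> = (\<integral>g. exp (\<Sum>i\<in>I. ?c i * g i) \<partial>gauss_vec I)"
    using has_bochner_integral_integral_eq[OF h] by simp
  also have "\<dots> \<le> (\<integral>g. (\<Sum>x\<in>T. w x * exp (s * (\<Sum>i\<in>I. a x i * g i))) powr \<theta> \<partial>gauss_vec I)"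
  proof (rule integral_mono[OF _ int])
    show "integrable (gauss_vec I) (\<lambda>g. exp (\<Sum>i\<in>I. ?c i * g i))"
      using h by (simp add: has_bochner_integral_iff)
    fix g :: "'a \<Rightarrow> real"
    have "exp (\<Sum>x\<in>T. w x * (s * (\<Sum>i\<in>I. a x i * g i))) \<le> (\<Sum>x\<in>T. w x * exp (s * (\<Sum>i\<in>I. a x i * g i)))"
      using convex_on_sum[OF assms(2,3) exp_convex, of w "\<lambda>x. s * (\<Sum>i\<in>I. a x i * g i)"] w by auto
    then have "exp (\<Sum>x\<in>T. w x * (s * (\<Sum>i\<in>I. a x i * g i))) powr \<theta> \<le> (\<Sum>x\<in>T. w x * exp (s * (\<Sum>i\<in>I. a x i * g i))) powr \<theta>"
      using \<open>0 \<le> \<theta>\<close> by (intro powr_mono2) auto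
    then show "exp (\<Sum>i\<in>I. ?c i * g i) \<le> (\<Sum>x\<in>T. w x * exp (s * (\<Sum>i\<in>I. a x i * g i))) powr \<theta>"
      unfolding eq[symmetric] by (simp add: powr_def)
  qed
  finally show ?thesis .
qed

lemma gauss_vec_powr_step:
  fixes a :: "'x \<Rightarrow> 'i \<Rightarrow> real" and b :: "'x \<Rightarrow> 'j \<Rightarrow> real"
  assumes fin: "finite I" "finite J" "finite T" "T \<noteq> {}"
    and var: "\<And>x. x \<in> T \<Longrightarrow> (\<Sum>i\<in>I. a x i * a x i) = (\<Sum>j\<in>J. b x j * b x j)"
    and cov: "\<And>x y. x \<in> T \<Longrightarrow> y \<in> T \<Longrightarrow> (\<Sum>j\<in>J. b x j * b y j) \<le> (\<Sum>i\<in>I. a x i * a y i)"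
    and V: "\<And>x. x \<in> T \<Longrightarrow> (\<Sum>i\<in>I. a x i * a x i) \<le> V"
    and s: "0 \<le> s" "s \<le> 1" and th: "0 < \<theta>" "\<theta> \<le> 1"
    and W: "\<And>x. x \<in> T \<Longrightarrow> 0 < W x"
  shows "(\<integral>\<^sup>+g. ennreal ((\<Sum>x\<in>T. W x * exp (s * (\<Sum>i\<in>I. a x i * g i))) powr \<theta>) \<partial>gauss_vec I)
    \<le> ennreal (1 + 1296 * exp (8 * V) * s ^ 3)
      * (\<integral>\<^sup>+g. ennreal ((\<Sum>x\<in>T. W x * exp (s * (\<Sum>j\<in>J. b x j * g j))) powr \<theta>) \<partial>gauss_vec J)"
proof -
  define S where "S = sum W T"
  define w where "w = (\<lambda>x. W x / S)"
  have S: "S > 0" unfolding S_def using fin W by (intro sum_pos) auto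
  have w: "0 \<le> w x" if "x \<in> T" for x using that W[of x] S by (simp add: w_def)
  have w1: "sum w T = 1" using S by (simp add: w_def S_def sum_divide_distrib[symmetric])
  let ?X = "\<lambda>g. \<Sum>x\<in>T. w x * exp (s * (\<Sum>i\<in>I. a x i * g i))"
  let ?Y = "\<lambda>g. \<Sum>x\<in>T. w x * exp (s * (\<Sum>j\<in>J. b x j * g j))"
  let ?A = "\<lambda>x y. \<Sum>i\<in>I. a x i * a y i"
  let ?B = "\<lambda>x y. \<Sum>j\<in>J. b x j * b y j"
  let ?m2 = "\<lambda>C. \<Sum>x\<in>T. \<Sum>y\<in>T. w x * w y * (exp (s\<^sup>2 * (C x x + C y y + 2 * C x y) / 2)
    - exp (s\<^sup>2 * C x x / 2) - exp (s\<^sup>2 * C y y / 2) + 1)"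
  let ?m1 = "\<lambda>C. \<Sum>x\<in>T. w x * (exp (s\<^sup>2 * C x x / 2) - 1)"
  let ?e = "648 * exp (8 * V) * s ^ 3"
  have X: "integrable (gauss_vec I) (\<lambda>g. ?X g powr \<theta>)"
      "\<bar>(\<integral>g. ?X g powr \<theta> \<partial>gauss_vec I) - (1 + \<theta> * ?m1 ?A - \<theta> * (1 - \<theta>) / 2 * ?m2 ?A)\<bar> \<le> ?e"
    using powr_exp_mean_expansion[where C = ?A and X = "\<lambda>x g. \<Sum>i\<in>I. a x i * g i", OF prob_space_gauss_vec fin(3) w w1
        borel_measurable_linear_gauss_vec has_bochner_integral_exp_gauss_vec_pair[OF fin(1)] V s th]
    by auto
  have VB: "?B x x \<le> V" if "x \<in> T" for x using V[OF that] var[OF that] by simp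
  have Y: "integrable (gauss_vec J) (\<lambda>g. ?Y g powr \<theta>)"
      "\<bar>(\<integral>g. ?Y g powr \<theta> \<partial>gauss_vec J) - (1 + \<theta> * ?m1 ?B - \<theta> * (1 - \<theta>) / 2 * ?m2 ?B)\<bar> \<le> ?e"
    using powr_exp_mean_expansion[where C = ?B and X = "\<lambda>x g. \<Sum>j\<in>J. b x j * g j", OF prob_space_gauss_vec fin(3) w w1
        borel_measurable_linear_gauss_vec has_bochner_integral_exp_gauss_vec_pair[OF fin(2)] VB s th]
    by auto
  have m1: "?m1 ?A = ?m1 ?B" using var by (intro sum.cong) auto
  have m2: "?m2 ?B \<le> ?m2 ?A"
  proof (intro sum_mono mult_left_mono)
    fix x y assume x: "x \<in> T" and y: "y \<in> T"
    have "s\<^sup>2 * (?B x x + ?B y y + 2 * ?B x y) / 2 \<le> s\<^sup>2 * (?A x x + ?A y y + 2 * ?A x y) / 2"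
      using var[OF x] var[OF y] cov[OF x y] by (intro divide_right_mono mult_left_mono) auto
    then show "exp (s\<^sup>2 * (?B x x + ?B y y + 2 * ?B x y) / 2) - exp (s\<^sup>2 * ?B x x / 2) - exp (s\<^sup>2 * ?B y y / 2) + 1
      \<le> exp (s\<^sup>2 * (?A x x + ?A y y + 2 * ?A x y) / 2) - exp (s\<^sup>2 * ?A x x / 2) - exp (s\<^sup>2 * ?A y y / 2) + 1"
      unfolding var[OF x] var[OF y] by simp
  qed (use w in auto)
  have aux: "x \<le> y + 2 * e" if "\<bar>x - (1 + \<theta> * m - c * p)\<bar> \<le> e" "\<bar>y - (1 + \<theta> * n - c * q)\<bar> \<le> e"
    "m = n" "c * q \<le> c * p" for x y e m n c p q :: real
    using that(1,2,4) unfolding that(3) abs_le_iff by linarith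
  have aux2: "x \<le> (1 + 2 * e) * y" if "x \<le> y + 2 * e" "2 * e * 1 \<le> 2 * e * y" for x y e :: real
    using that by (simp add: distrib_right)
  have "\<theta> * (1 - \<theta>) / 2 * ?m2 ?B \<le> \<theta> * (1 - \<theta>) / 2 * ?m2 ?A"
    using th m2 by (intro mult_left_mono) auto
  then have "(\<integral>g. ?X g powr \<theta> \<partial>gauss_vec I) \<le> (\<integral>g. ?Y g powr \<theta> \<partial>gauss_vec J) + 2 * ?e"
    by (rule aux[OF X(2) Y(2) m1])
  moreover have "1 \<le> (\<integral>g. ?Y g powr \<theta> \<partial>gauss_vec J)"
    using gauss_vec_powr_lower_bound[OF fin(2-4) w w1 _ Y(1)] th by simp
  then have "2 * ?e * 1 \<le> 2 * ?e * (\<integral>g. ?Y g powr \<theta> \<partial>gauss_vec J)"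
    using s by (intro mult_left_mono) auto
  ultimately have le: "(\<integral>g. ?X g powr \<theta> \<partial>gauss_vec I) \<le> (1 + 2 * ?e) * (\<integral>g. ?Y g powr \<theta> \<partial>gauss_vec J)"
    by (rule aux2)
  \<comment> \<open>Homogeneity: passing from \<open>W\<close> to the normalised weights costs the
    same factor \<open>S powr \<theta>\<close> on both sides.\<close>
  have scale: "(\<integral>\<^sup>+g. ennreal ((\<Sum>x\<in>T. W x * exp (L x g)) powr \<theta>) \<partial>M)
      = ennreal (S powr \<theta> * (\<integral>g. (\<Sum>x\<in>T. w x * exp (L x g)) powr \<theta> \<partial>M))"
    if "integrable M (\<lambda>g. (\<Sum>x\<in>T. w x * exp (L x g)) powr \<theta>)" for M :: "'c measure" and L
  proof -
    have "(\<Sum>x\<in>T. W x * exp (L x g)) = S * (\<Sum>x\<in>T. w x * exp (L x g))" for g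
      using S by (simp add: sum_distrib_left w_def)
    moreover have "0 \<le> (\<Sum>x\<in>T. w x * exp (L x g))" for g using w by (intro sum_nonneg) auto
    ultimately have "(\<integral>\<^sup>+g. ennreal ((\<Sum>x\<in>T. W x * exp (L x g)) powr \<theta>) \<partial>M)
      = (\<integral>\<^sup>+g. ennreal (S powr \<theta> * (\<Sum>x\<in>T. w x * exp (L x g)) powr \<theta>) \<partial>M)"
      using S by (simp add: powr_mult)
    also have "\<dots> = ennreal (\<integral>g. S powr \<theta> * (\<Sum>x\<in>T. w x * exp (L x g)) powr \<theta> \<partial>M)"
      using that by (intro nn_integral_eq_integral) auto
    finally show ?thesis by simp
  qed
  have K: "0 \<le> 1 + 2 * ?e" using s by simp
  have "S powr \<theta> * (\<integral>g. ?X g powr \<theta> \<partial>gauss_vec I)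
      \<le> (1 + 2 * ?e) * (S powr \<theta> * (\<integral>g. ?Y g powr \<theta> \<partial>gauss_vec J))"
    using mult_left_mono[OF le, of "S powr \<theta>"] by (simp add: mult_ac)
  then show ?thesis
    unfolding scale[OF X(1)] scale[OF Y(1)]
    using K by (simp add: ennreal_mult'[symmetric] ennreal_leI mult.assoc)
qed

text \<open>A field scaled to variance parameter \<open>s + t\<close> is a sum of independent copies
  with parameters \<open>s\<close> and \<open>t\<close>: this is \<open>gauss_vec_rotate\<close>
  with the ratios of square roots as coefficients. If \<open>s + t = 0\<close> these ratios are
  meaningless and both sides are constant.\<close>

lemma gauss_vec_rotate_linear:
  fixes G :: "('x \<Rightarrow> real) \<Rightarrow> ennreal"
  assumes "finite I" "0 \<le> s" "0 \<le> t"
    and G: "(\<lambda>g. G (\<lambda>x. sqrt (s + t) * (\<Sum>i\<in>I. a x i * g i))) \<in> borel_measurable (gauss_vec I)"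
  shows "(\<integral>\<^sup>+g. G (\<lambda>x. sqrt (s + t) * (\<Sum>i\<in>I. a x i * g i)) \<partial>gauss_vec I)
    = (\<integral>\<^sup>+g. \<integral>\<^sup>+h. G (\<lambda>x. sqrt s * (\<Sum>i\<in>I. a x i * g i) + sqrt t * (\<Sum>i\<in>I. a x i * h i)) \<partial>gauss_vec I \<partial>gauss_vec I)"
proof (cases "s + t = 0")
  case True
  then have "s = 0" "t = 0" using assms by auto
  then show ?thesis by (simp add: gauss_vec.emeasure_space_1)
next
  case False
  then have st: "0 < s + t" using assms by simp
  define p where "p = sqrt s / sqrt (s + t)"
  define q where "q = sqrt t / sqrt (s + t)"
  have "p\<^sup>2 + q\<^sup>2 = 1" using assms st by (simp add: p_def q_def power_divide add_divide_distrib[symmetric])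
  moreover have "0 \<le> p" "0 \<le> q" using assms by (simp_all add: p_def q_def)
  moreover have "sqrt (s + t) * (\<Sum>i\<in>I. a x i * (\<lambda>i\<in>I. p * g i + q * h i) i)
      = sqrt s * (\<Sum>i\<in>I. a x i * g i) + sqrt t * (\<Sum>i\<in>I. a x i * h i)" for x g h
  proof -
    have "sqrt (s + t) * p = sqrt s" "sqrt (s + t) * q = sqrt t"
      using st by (simp_all add: p_def q_def)
    then show ?thesis
      unfolding \<open>sqrt (s + t) * p = sqrt s\<close>[symmetric] \<open>sqrt (s + t) * q = sqrt t\<close>[symmetric]
      by (simp add: sum_distrib_left sum.distrib[symmetric] algebra_simps)
  qed
  ultimately show ?thesis
    using gauss_vec_rotate[OF \<open>finite I\<close> G, of p q] by simp
qed

section \<open>Gaussian comparison\<close>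

text \<open>An inequality of Kahane's type: for \<open>\<theta> \<le> 1\<close> the power is
  concave, so more strongly correlated summands give a smaller mean. The interpolation
  \<open>\<psi>\<close> runs from the field of \<open>b\<close> at 0 to that of \<open>a\<close> at
  1.\<close>

theorem gauss_vec_powr_comparison:
  fixes a :: "'x \<Rightarrow> 'i \<Rightarrow> real" and b :: "'x \<Rightarrow> 'j \<Rightarrow> real"
  assumes fin: "finite I" "finite J" "finite T" "T \<noteq> {}"
    and var: "\<And>x. x \<in> T \<Longrightarrow> (\<Sum>i\<in>I. a x i * a x i) = (\<Sum>j\<in>J. b x j * b x j)"
    and cov: "\<And>x y. x \<in> T \<Longrightarrow> y \<in> T \<Longrightarrow> (\<Sum>j\<in>J. b x j * b y j) \<le> (\<Sum>i\<in>I. a x i * a y i)"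
    and th: "0 < \<theta>" "\<theta> \<le> 1"
  shows "(\<integral>\<^sup>+g. ennreal ((\<Sum>x\<in>T. exp (\<Sum>i\<in>I. a x i * g i)) powr \<theta>) \<partial>gauss_vec I)
    \<le> (\<integral>\<^sup>+g. ennreal ((\<Sum>x\<in>T. exp (\<Sum>j\<in>J. b x j * g j)) powr \<theta>) \<partial>gauss_vec J)"
proof -
  define X where "X = (\<lambda>x g. \<Sum>i\<in>I. a x i * g i)"
  define Y where "Y = (\<lambda>x g. \<Sum>j\<in>J. b x j * g j)"
  define F where "F = (\<lambda>v :: 'x \<Rightarrow> real. ennreal ((\<Sum>x\<in>T. exp (v x)) powr \<theta>))"
  \<comment> \<open>The variance of \<open>X\<close> is traded for that of \<open>Y\<close> in \<open>N\<close> equal steps; each costs a factor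
    \<open>1 + O(N powr (- 3/2))\<close>.\<close>
  define \<psi> where "\<psi> = (\<lambda>t. \<integral>\<^sup>+g. \<integral>\<^sup>+k. F (\<lambda>x. sqrt t * X x g + sqrt (1 - t) * Y x k) \<partial>gauss_vec J \<partial>gauss_vec I)"
  define V where "V = Max ((\<lambda>x. \<Sum>i\<in>I. a x i * a x i) ` T)"
  define K where "K = 1296 * exp (8 * V)"
  have K: "0 \<le> K" by (simp add: K_def)
  have V: "(\<Sum>i\<in>I. a x i * a x i) \<le> V" if "x \<in> T" for x
    unfolding V_def using that fin by (intro Max_ge) auto
  have mX [measurable]: "X x \<in> borel_measurable (gauss_vec I)" for x
    unfolding X_def by measurable
  have mY [measurable]: "Y x \<in> borel_measurable (gauss_vec J)" for x
    unfolding Y_def by measurable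
  have pair: "pair_sigma_finite (gauss_vec J) (gauss_vec I)" by unfold_locales
  \<comment> \<open>An independent piece of variance \<open>h\<close> is split off from
    \<open>X\<close> and replaced by one of \<open>Y\<close>. The pieces with parameters
    \<open>t\<close> and \<open>r\<close> stay fixed and enter \<open>gauss_vec_powr_step\<close> as
    weights.\<close>
  have step: "\<psi> (t + h) \<le> ennreal (1 + K * sqrt h ^ 3) * \<psi> t" if t: "0 \<le> t" "0 \<le> h" "t + h \<le> 1" for t h
  proof -
    define r where "r = 1 - t - h"
    have r: "0 \<le> r" "1 - (t + h) = r" "1 - t = r + h" using t by (simp_all add: r_def)
    have "\<psi> (t + h) = (\<integral>\<^sup>+g. \<integral>\<^sup>+g'. \<integral>\<^sup>+k. F (\<lambda>x. sqrt t * X x g + sqrt h * X x g' + sqrt r * Y x k)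
        \<partial>gauss_vec J \<partial>gauss_vec I \<partial>gauss_vec I)"
      unfolding \<psi>_def r(2) X_def
      by (rule gauss_vec_rotate_linear[OF fin(1) t(1,2), where
            G = "\<lambda>v. \<integral>\<^sup>+k. F (\<lambda>x. v x + sqrt r * Y x k) \<partial>gauss_vec J"])
         (unfold X_def[symmetric] F_def, measurable)
    also have "\<dots> = (\<integral>\<^sup>+g. \<integral>\<^sup>+k. \<integral>\<^sup>+g'. F (\<lambda>x. sqrt t * X x g + sqrt h * X x g' + sqrt r * Y x k)
        \<partial>gauss_vec I \<partial>gauss_vec J \<partial>gauss_vec I)"
      by (intro nn_integral_cong pair_sigma_finite.Fubini'[OF pair]) (unfold F_def, measurable)
    also have "\<dots> \<le> (\<integral>\<^sup>+g. \<integral>\<^sup>+k. ennreal (1 + K * sqrt h ^ 3)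
        * (\<integral>\<^sup>+k'. F (\<lambda>x. sqrt t * X x g + sqrt r * Y x k + sqrt h * Y x k') \<partial>gauss_vec J) \<partial>gauss_vec J \<partial>gauss_vec I)"
    proof (intro nn_integral_mono)
      fix g k
      show "(\<integral>\<^sup>+g'. F (\<lambda>x. sqrt t * X x g + sqrt h * X x g' + sqrt r * Y x k) \<partial>gauss_vec I)
        \<le> ennreal (1 + K * sqrt h ^ 3)
        * (\<integral>\<^sup>+k'. F (\<lambda>x. sqrt t * X x g + sqrt r * Y x k + sqrt h * Y x k') \<partial>gauss_vec J)"
        using gauss_vec_powr_step[where a = a and b = b and s = "sqrt h" and \<theta> = \<theta> and W = "\<lambda>x. exp (sqrt t * X x g + sqrt r * Y x k)", OF fin var cov V] th t
        by (simp add: F_def K_def X_def Y_def mult_exp_exp add_ac)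
    qed
    also have "\<dots> = ennreal (1 + K * sqrt h ^ 3) * (\<integral>\<^sup>+g. \<integral>\<^sup>+k. \<integral>\<^sup>+k'.
        F (\<lambda>x. sqrt t * X x g + (sqrt r * Y x k + sqrt h * Y x k')) \<partial>gauss_vec J \<partial>gauss_vec J \<partial>gauss_vec I)"
      unfolding F_def by (simp add: nn_integral_cmult add.assoc)
    also have "\<dots> = ennreal (1 + K * sqrt h ^ 3) * \<psi> t"
      unfolding \<psi>_def r(3) Y_def
      by (intro arg_cong2[where f = "(*)"] refl nn_integral_cong
            gauss_vec_rotate_linear[OF fin(2) r(1) t(2), symmetric, where G = "\<lambda>v. F (\<lambda>x. sqrt t * X x g + v x)" for g])
         (unfold Y_def[symmetric] F_def, measurable)
    finally show ?thesis .
  qed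
  have "\<psi> (real k / real N) \<le> ennreal ((1 + K * sqrt (1 / real N) ^ 3) ^ k) * \<psi> 0" if "k \<le> N" "N > 0" for k N
    using that
  proof (induction k)
    case (Suc k)
    have "\<psi> (real (Suc k) / real N) = \<psi> (real k / real N + 1 / real N)"
      by (simp add: add_divide_distrib add.commute)
    also have "\<dots> \<le> ennreal (1 + K * sqrt (1 / real N) ^ 3) * \<psi> (real k / real N)"
      using Suc.prems by (intro step) (auto simp: add_divide_distrib[symmetric])
    also have "\<dots> \<le> ennreal (1 + K * sqrt (1 / real N) ^ 3) * (ennreal ((1 + K * sqrt (1 / real N) ^ 3) ^ k) * \<psi> 0)"
      using Suc by (intro mult_left_mono) auto
    finally show ?case using K by (simp add: ennreal_mult mult.assoc)
  qed simp
  from this[of N N for N] have le: "\<psi> 1 \<le> ennreal ((1 + K * sqrt (1 / real N) ^ 3) ^ N) * \<psi> 0" if "N > 0" for N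
    using that by simp
  \<comment> \<open>Each of the \<open>N\<close> factors exceeds 1 by order
    \<open>N powr (- 3/2)\<close>, so their product tends to 1.\<close>
  have "\<psi> 1 \<le> ennreal (exp (K / sqrt (real N))) * \<psi> 0" if "N > 0" for N
  proof -
    have "(1 + K * sqrt (1 / real N) ^ 3) ^ N \<le> exp (K * sqrt (1 / real N) ^ 3) ^ N"
      using K by (intro power_mono) auto
    also have "\<dots> = exp (real N * (K * sqrt (1 / real N) ^ 3))" by (simp add: exp_of_nat_mult)
    also have "real N * (K * sqrt (1 / real N) ^ 3) = K / sqrt (real N)"
      using that by (simp add: real_sqrt_divide power3_eq_cube field_simps)
    finally show ?thesis using le[OF that] by (meson ennreal_leI mult_right_mono order_trans zero_le)
  qed
  moreover have "(\<lambda>N. ennreal (exp (K / sqrt (real N))) * \<psi> 0) \<longlonglongrightarrow> ennreal (exp 0) * \<psi> 0"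
  proof (intro tendsto_mult_ennreal tendsto_ennrealI tendsto_exp tendsto_const)
    show "(\<lambda>N. K / sqrt (real N)) \<longlonglongrightarrow> 0"
      by (intro tendsto_divide_0[OF tendsto_const] filterlim_at_top_imp_at_infinity
          filterlim_compose[OF sqrt_at_top filterlim_real_sequentially])
  qed auto
  ultimately have "\<psi> 1 \<le> ennreal (exp 0) * \<psi> 0"
    by (intro LIMSEQ_le_const) (auto intro!: exI[of _ 1])
  then show ?thesis
    by (simp add: \<psi>_def F_def X_def Y_def gauss_vec.emeasure_space_1)
qed

section \<open>The complementary error function\<close>

lemma integrable_exp_neg_square: "integrable lborel (\<lambda>t::real. exp (- (t\<^sup>2)))"
proof -
  have "exp (- (t\<^sup>2)) = sqrt pi * normal_density 0 (1 / sqrt 2) t" for t :: real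
    by (simp add: normal_density_def power_divide)
  then show ?thesis by simp
qed

lemma set_integrable_exp_neg_square:
  "A \<in> sets borel \<Longrightarrow> set_integrable lborel A (\<lambda>t::real. exp (- (t\<^sup>2)))"
  unfolding set_integrable_def
  using integrable_mult_indicator[OF _ integrable_exp_neg_square, of A] by simp

text \<open>The tail integral is a constant minus an integral over a compact interval, to which the
  fundamental theorem of calculus applies. The base point \<open>x - 1\<close> lies left of
  \<open>x\<close>, so this decomposition holds in a neighbourhood of \<open>x\<close>.\<close>

lemma has_real_derivative_erfc: "(erfc has_real_derivative - (2 / sqrt pi * exp (- (x\<^sup>2)))) (at x)"
proof -
  let ?f = "\<lambda>t::real. exp (- (t\<^sup>2))"
  let ?a = "x - 1"
  have int: "?f integrable_on A" if "A \<in> sets borel" for A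
    using set_borel_integral_eq_integral(1)[OF set_integrable_exp_neg_square[OF that]] .
  have integral_tail: "integral {y..} ?f = integral {?a..} ?f - integral {?a..y} ?f" if "?a \<le> y" for y
  proof -
    have "{?a..} = {?a..y} \<union> {y..}" "{?a..y} \<inter> {y..} = {y}" using that by auto
    then show ?thesis
      using integral_Un[of ?f "{?a..y}" "{y..}"] int by simp
  qed
  have "((\<lambda>y. integral {?a..y} ?f) has_real_derivative ?f x) (at x within {?a..x + 1})"
    by (rule integral_has_real_derivative) (auto intro!: continuous_intros)
  then have "((\<lambda>y. integral {?a..y} ?f) has_real_derivative ?f x) (at x)"
    by (subst (asm) at_within_Icc_at) auto
  then have "((\<lambda>y. 2 / sqrt pi * (integral {?a..} ?f - integral {?a..y} ?f)) has_real_derivative - (2 / sqrt pi * ?f x)) (at x)"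
    by (auto intro!: derivative_eq_intros simp del: times_divide_eq_left times_divide_eq_right)
  then show ?thesis
  proof (rule DERIV_cong_ev[OF refl _ refl, THEN iffD1, rotated])
    have "eventually (\<lambda>y. y \<in> {?a<..}) (nhds x)"
      by (intro eventually_nhds_in_open) auto
    then show "eventually (\<lambda>y. 2 / sqrt pi * (integral {?a..} ?f - integral {?a..y} ?f) = erfc y) (nhds x)"
      by eventually_elim (simp add: erfc_def flip: integral_tail)
  qed
qed

lemma nn_integral_even:
  fixes f :: "real \<Rightarrow> ennreal"
  assumes [measurable]: "f \<in> borel_measurable borel" and even: "\<And>x. f (- x) = f x"
  shows "(\<integral>\<^sup>+x. f x \<partial>lborel) = 2 * (\<integral>\<^sup>+x. f x * indicator {0..} x \<partial>lborel)"
proof -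
  have "(\<integral>\<^sup>+x. f x \<partial>lborel) = (\<integral>\<^sup>+x. f x * indicator {0..} x + f x * indicator {..<0} x \<partial>lborel)"
    by (intro nn_integral_cong) (auto split: split_indicator)
  also have "\<dots> = (\<integral>\<^sup>+x. f x * indicator {0..} x \<partial>lborel) + (\<integral>\<^sup>+x. f x * indicator {..<0} x \<partial>lborel)"
    by (intro nn_integral_add) auto
  also have "(\<integral>\<^sup>+x. f x * indicator {..<0} x \<partial>lborel)
    = ennreal \<bar>- 1\<bar> * (\<integral>\<^sup>+x. f (0 + - 1 * x) * indicator {..<0} (0 + - 1 * x) \<partial>lborel)"
    by (rule nn_integral_real_affine) auto
  also have "\<dots> = (\<integral>\<^sup>+x. f x * indicator {0<..} x \<partial>lborel)"
    by (simp add: even indicator_def)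
  also have "\<dots> = (\<integral>\<^sup>+x. f x * indicator {0..} x \<partial>lborel)"
    by (intro nn_integral_cong_AE AE_I[where N = "{0}"]) (auto split: split_indicator)
  finally show ?thesis by (simp add: mult_2)
qed

text \<open>The source of \<open>erfc\<close> in the rate. By symmetry the integral is twice that
  over the half-line, and the substitution \<open>x = a + sqrt 2 * t\<close> completes the square
  and leaves a tail of \<open>exp (- (t\<^sup>2))\<close>.\<close>

lemma nn_integral_exp_abs_gauss:
  "(\<integral>\<^sup>+x. ennreal (exp (a * \<bar>x\<bar>)) \<partial>gauss) = ennreal (exp (a\<^sup>2 / 2) * erfc (- (a / sqrt 2)))"
proof -
  let ?f = "\<lambda>t::real. exp (- (t\<^sup>2))"
  let ?A = "{- (a / sqrt 2)..}"
  have pull: "2 * (ennreal b * (ennreal k * ennreal i)) = ennreal (2 * (b * (k * i)))"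
    if "0 \<le> b" "0 \<le> k" for b k i
    using that by (simp add: ennreal_mult')
  have "(\<integral>\<^sup>+x. ennreal (exp (a * \<bar>x\<bar>)) \<partial>gauss) = (\<integral>\<^sup>+x. ennreal (std_normal_density x * exp (a * \<bar>x\<bar>)) \<partial>lborel)"
    by (subst nn_integral_gauss) (auto simp: ennreal_mult)
  also have "\<dots> = 2 * (\<integral>\<^sup>+x. ennreal (std_normal_density x * exp (a * \<bar>x\<bar>)) * indicator {0..} x \<partial>lborel)"
    by (rule nn_integral_even) (auto simp: normal_density_def)
  also have "(\<integral>\<^sup>+x. ennreal (std_normal_density x * exp (a * \<bar>x\<bar>)) * indicator {0..} x \<partial>lborel)
    = ennreal \<bar>sqrt 2\<bar> * (\<integral>\<^sup>+t. ennreal (std_normal_density (a + sqrt 2 * t) * exp (a * \<bar>a + sqrt 2 * t\<bar>))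
        * indicator {0..} (a + sqrt 2 * t) \<partial>lborel)"
    by (rule nn_integral_real_affine) auto
  also have "(\<integral>\<^sup>+t. ennreal (std_normal_density (a + sqrt 2 * t) * exp (a * \<bar>a + sqrt 2 * t\<bar>))
        * indicator {0..} (a + sqrt 2 * t) \<partial>lborel)
    = (\<integral>\<^sup>+t. ennreal (exp (a\<^sup>2 / 2) / sqrt (2 * pi)) * ennreal (indicator ?A t *\<^sub>R ?f t) \<partial>lborel)"
  proof (rule nn_integral_cong)
    fix t :: real
    have ind: "0 \<le> a + sqrt 2 * t \<longleftrightarrow> t \<in> ?A" by (auto simp: field_simps)
    show "ennreal (std_normal_density (a + sqrt 2 * t) * exp (a * \<bar>a + sqrt 2 * t\<bar>)) * indicator {0..} (a + sqrt 2 * t)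
      = ennreal (exp (a\<^sup>2 / 2) / sqrt (2 * pi)) * ennreal (indicator ?A t *\<^sub>R ?f t)"
    proof (cases "t \<in> ?A")
      case True
      then have "0 \<le> a + sqrt 2 * t" using ind by blast
      moreover have "- (a + sqrt 2 * t)\<^sup>2 / 2 + a * (a + sqrt 2 * t) = a\<^sup>2 / 2 - t\<^sup>2"
        by (simp add: power2_eq_square field_simps)
      then have "std_normal_density (a + sqrt 2 * t) * exp (a * (a + sqrt 2 * t)) = exp (a\<^sup>2 / 2) / sqrt (2 * pi) * ?f t"
        by (simp add: std_normal_density_def mult_exp_exp)
      ultimately show ?thesis using True by (simp flip: ennreal_mult)
    qed (use ind in auto)
  qed
  also have "\<dots> = ennreal (exp (a\<^sup>2 / 2) / sqrt (2 * pi)) * ennreal (integral ?A ?f)"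
  proof (subst nn_integral_cmult)
    have "(\<integral>\<^sup>+t. ennreal (indicator ?A t *\<^sub>R ?f t) \<partial>lborel) = ennreal (LINT t:?A|lborel. ?f t)"
      unfolding set_lebesgue_integral_def
      using set_integrable_exp_neg_square[of ?A] unfolding set_integrable_def
      by (intro nn_integral_eq_integral) auto
    then show "ennreal (exp (a\<^sup>2 / 2) / sqrt (2 * pi)) * (\<integral>\<^sup>+t. ennreal (indicator ?A t *\<^sub>R ?f t) \<partial>lborel)
      = ennreal (exp (a\<^sup>2 / 2) / sqrt (2 * pi)) * ennreal (integral ?A ?f)"
      using set_borel_integral_eq_integral(2)[OF set_integrable_exp_neg_square[of ?A]] by simp
  qed simp
  also have "2 * (ennreal \<bar>sqrt 2\<bar> * (ennreal (exp (a\<^sup>2 / 2) / sqrt (2 * pi)) * ennreal (integral ?A ?f)))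
    = ennreal (2 * (sqrt 2 * (exp (a\<^sup>2 / 2) / sqrt (2 * pi) * integral ?A ?f)))"
    by (subst pull[symmetric]) auto
  also have "2 * (sqrt 2 * (exp (a\<^sup>2 / 2) / sqrt (2 * pi) * integral ?A ?f)) = exp (a\<^sup>2 / 2) * erfc (- (a / sqrt 2))"
    by (simp add: erfc_def real_sqrt_mult)
  finally show ?thesis .
qed

text \<open>With \<open>a = - sqrt 2 * x\<close> in \<open>nn_integral_exp_abs_gauss\<close>,
  \<open>erfc x\<close> is a positive multiple of the integral of a positive function.\<close>

lemma erfc_pos: "0 < erfc x"
proof -
  have "(\<integral>\<^sup>+t. ennreal (exp (- sqrt 2 * x * \<bar>t\<bar>)) \<partial>gauss) \<noteq> 0"
  proof
    assume "(\<integral>\<^sup>+t. ennreal (exp (- sqrt 2 * x * \<bar>t\<bar>)) \<partial>gauss) = 0"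
    then have "AE t in gauss. ennreal (exp (- sqrt 2 * x * \<bar>t\<bar>)) = 0"
      by (subst (asm) nn_integral_0_iff_AE) (rule borel_measurable_gauss, measurable)
    then show False by simp
  qed
  then show ?thesis
    unfolding nn_integral_exp_abs_gauss by (simp add: ennreal_eq_0_iff zero_less_mult_iff not_le)
qed

text \<open>The derivative vanishes at the interior minimum, which reads
  \<open>?D / ?E = u - c\<close>. Here \<open>?D\<close> equals
  \<open>sqrt (2 * p / pi) * exp (- (c\<^sup>2 * p / 2))\<close>, the reciprocal of the factor
  beside \<open>u - c\<close> in the claim.\<close>

lemma erfc_minimizer_equation:
  fixes p u c :: real
  assumes "0 < c" "0 < p"
    and min: "\<forall>d>0. c\<^sup>2 / 2 + ln (erfc (- (c * sqrt p / sqrt 2))) - c * u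
                   \<le> d\<^sup>2 / 2 + ln (erfc (- (d * sqrt p / sqrt 2))) - d * u"
  shows "1 / erfc (- (c * sqrt p / sqrt 2)) = exp (c\<^sup>2 * p / 2) * (u - c) * sqrt (pi / (2 * p))"
proof -
  let ?h = "\<lambda>d. d\<^sup>2 / 2 + ln (erfc (- (d * sqrt p / sqrt 2))) - d * u"
  let ?E = "erfc (- (c * sqrt p / sqrt 2))"
  let ?D = "sqrt p / sqrt 2 * (2 / sqrt pi * exp (- (c\<^sup>2 * p / 2)))"
  have sq: "(c * sqrt p / sqrt 2)\<^sup>2 = c\<^sup>2 * p / 2"
    using assms by (simp add: power_mult_distrib power_divide)
  have "((\<lambda>d. erfc (- (d * sqrt p / sqrt 2))) has_real_derivative ?D) (at c)"
  proof (rule DERIV_cong[OF DERIV_chain2[OF has_real_derivative_erfc]])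
    show "((\<lambda>d. - (d * sqrt p / sqrt 2)) has_real_derivative - (sqrt p / sqrt 2)) (at c)"
      using DERIV_cmult_Id[of "- (sqrt p / sqrt 2)" c] by (rule DERIV_cong_ev[THEN iffD1, rotated -1]) auto
  qed (simp add: sq mult_ac)
  from DERIV_chain2[OF DERIV_ln[OF erfc_pos] this]
  have ln': "((\<lambda>d. ln (erfc (- (d * sqrt p / sqrt 2)))) has_real_derivative inverse ?E * ?D) (at c)" .
  have sq': "((\<lambda>d. d\<^sup>2 / 2) has_real_derivative c) (at c)"
    by (auto intro!: derivative_eq_intros)
  have "(?h has_real_derivative c + inverse ?E * ?D - 1 * u) (at c)"
    by (intro DERIV_diff DERIV_add sq' ln' DERIV_cmult_right DERIV_ident)
  then have "c + inverse ?E * ?D - 1 * u = 0"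
  \<comment> \<open>Radius \<open>c\<close> keeps the neighbourhood inside the positive reals, where
    minimality is assumed.\<close>
  proof (rule DERIV_local_min[OF _ \<open>0 < c\<close>], intro allI impI)
    fix y assume "\<bar>c - y\<bar> < c"
    then have "0 < y" by linarith
    then show "?h c \<le> ?h y" using min by blast
  qed
  moreover have "x / e = u - c" if "c + inverse e * x - 1 * u = 0" for x e
    using that by (simp add: divide_inverse mult.commute[of x])
  ultimately have D: "?D / ?E = u - c" by blast
  have "A / C * (2 / B * X) * (Y * (B / (C * A))) = 1"
    if "A > 0" "B > 0" "C > 0" "C * C = 2" "X * Y = 1" for A B C X Y :: real
  proof -
    have "A / C * (2 / B * X) * (Y * (B / (C * A))) = 2 * (X * Y) / (C * C)"
      using that(1-3) by (simp add: field_simps)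
    also have "\<dots> = 1" unfolding that(4,5) by simp
    finally show ?thesis .
  qed
  note cancel = this[of "sqrt p" "sqrt pi" "sqrt 2" "exp (- (c\<^sup>2 * p / 2))" "exp (c\<^sup>2 * p / 2)"]
  have DX: "?D * (exp (c\<^sup>2 * p / 2) * sqrt (pi / (2 * p))) = 1"
    unfolding real_sqrt_divide real_sqrt_mult
  proof (rule cancel)
    show "exp (- (c\<^sup>2 * p / 2)) * exp (c\<^sup>2 * p / 2) = 1"
      using exp_minus_inverse[of "c\<^sup>2 * p / 2"] by (simp only: mult.commute)
  qed (use assms(2) in auto)
  have "1 / e = x * v * y" if "d / e = v" "d * (x * y) = 1" "e > 0" for d e v x y :: real
  proof -
    have "d = v * e" using that(1,3) by (auto simp: nonzero_divide_eq_eq)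
    then have "x * v * y * e = 1" using that(2) by (simp add: mult_ac)
    then show ?thesis using that(3) by (simp add: nonzero_divide_eq_eq)
  qed
  from this[OF D DX erfc_pos] show ?thesis .
qed

section \<open>The tensor form on the cube\<close>

text \<open>Moves expectations from the given probability space to the product measure on which the
  comparison is proved.\<close>

lemma distr_indep_std_normal:
  assumes M: "prob_space M" and "I \<noteq> {}"
    and indep: "prob_space.indep_vars M (\<lambda>_. borel) X I"
    and normal: "\<And>i. i \<in> I \<Longrightarrow> distributed M lborel (X i) std_normal_density"
  shows "distr M (PiM I (\<lambda>_. borel)) (\<lambda>\<omega>. \<lambda>i\<in>I. X i \<omega>) = gauss_vec I"
proof -
  interpret M: prob_space M by fact
  have rv: "X i \<in> borel_measurable M" if "i \<in> I" for i
    by (subst measurable_cong_sets[OF refl sets_lborel[symmetric]])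
       (rule distributed_measurable[OF normal[OF that]])
  have "distr M borel (X i) = gauss" if "i \<in> I" for i
  proof -
    have "distr M borel (X i) = distr M lborel (X i)" by (rule distr_cong) auto
    then show ?thesis
      using distributed_distr_eq_density[OF normal[OF that]] by (simp add: gauss_def)
  qed
  then show ?thesis
    unfolding gauss_vec_def
    using M.indep_vars_iff_distr_eq_PiM'[OF \<open>I \<noteq> {}\<close> rv, THEN iffD1, OF _ indep]
    by (auto cong: PiM_cong)
qed

lemma finite_idx_set: "finite (idx_set p n)"
  unfolding idx_set_def by (intro finite_PiE) auto

lemma Bcube_eq_PiE:
  assumes "0 < n"
  shows "Bcube n = PiE {..<n} (\<lambda>_. {1 / sqrt (real n), - 1 / sqrt (real n)})"
proof -
  have "y\<^sup>2 = 1 / real n \<longleftrightarrow> y = 1 / sqrt (real n) \<or> y = - 1 / sqrt (real n)" for y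
    using power2_eq_iff[of y "1 / sqrt (real n)"] by (simp add: power_divide)
  then show ?thesis by (auto simp: Bcube_def PiE_def Pi_def extensional_def)
qed

lemma
  assumes "0 < n"
  shows finite_Bcube: "finite (Bcube n)" and Bcube_nonempty: "Bcube n \<noteq> {}"
    and card_Bcube: "card (Bcube n) \<le> 2 ^ n"
proof -
  have "card (Bcube n) = (\<Prod>i<n. card {1 / sqrt (real n), - 1 / sqrt (real n)})"
    unfolding Bcube_eq_PiE[OF assms] by (rule card_PiE) simp
  also have "\<dots> \<le> 2 ^ n"
    using prod_mono[of "{..<n}" "\<lambda>_. card {1 / sqrt (real n), - 1 / sqrt (real n)}" "\<lambda>_. 2"] 
    by (simp add: card_insert_if)
  finally show "card (Bcube n) \<le> 2 ^ n" .
qed (auto simp: Bcube_eq_PiE[OF assms] PiE_eq_empty_iff intro!: finite_PiE)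

lemma sum_Bcube_sq:
  assumes "0 < n" "x \<in> Bcube n"
  shows "(\<Sum>i<n. x i * x i) = 1"
proof -
  have "(\<Sum>i<n. x i * x i) = (\<Sum>i<n. 1 / real n)"
    using assms by (intro sum.cong) (auto simp: Bcube_def power2_eq_square)
  then show ?thesis using assms by simp
qed

text \<open>Expanding the power gives a sum over all index tuples. This is the covariance of the
  tensor form at \<open>x\<close> and \<open>y\<close>.\<close>

lemma sum_idx_set_prod: "(\<Sum>ii\<in>idx_set p n. (\<Prod>k<p. x (ii k)) * (\<Prod>k<p. y (ii k))) = (\<Sum>i<n. x i * y i :: real) ^ p"
  unfolding idx_set_def prod.distrib[symmetric]
  by (subst prod_sum_PiE[symmetric]) auto

text \<open>The objective inside \<open>zeta\<close>, with the coefficient in front of the Gaussian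
  variable as in the linear fields above.\<close>

definition tensor_form :: "nat \<Rightarrow> nat \<Rightarrow> ((nat \<Rightarrow> nat) \<Rightarrow> real) \<Rightarrow> (nat \<Rightarrow> real) \<Rightarrow> real" where
  "tensor_form p n g x = (\<Sum>ii\<in>idx_set p n. (\<Prod>k<p. x (ii k)) * g ii)"

lemma zeta_ge_iff:
  assumes "0 < n"
  shows "u \<le> zeta p n g \<longleftrightarrow> (\<exists>x\<in>Bcube n. u * sqrt (real n) \<le> tensor_form p n g x)"
proof -
  have "u \<le> zeta p n g \<longleftrightarrow> u * sqrt (real n) \<le> Max (tensor_form p n g ` Bcube n)"
    using assms unfolding zeta_def tensor_form_def by (simp add: field_simps mult.commute)
  also have "\<dots> \<longleftrightarrow> (\<exists>x\<in>Bcube n. u * sqrt (real n) \<le> tensor_form p n g x)"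
    using finite_Bcube[OF assms] Bcube_nonempty[OF assms] by (subst Max_ge_iff) auto
  finally show ?thesis .
qed

section \<open>Comparison and evaluation of the partition functions\<close>

text \<open>Applies \<open>gauss_vec_powr_comparison\<close> to the form plus an auxiliary Gaussian.
  On the cube both fields have variance \<open>\<beta>\<^sup>2 * p\<close>, and Bernoulli's
  inequality orders the covariances. The factor on the left is the contribution of the auxiliary
  variable.\<close>

lemma nn_integral_tensor_partition_le:
  fixes c \<theta> :: real
  assumes p: "even p" "0 < p" and n: "0 < n" and th: "0 < \<theta>" "\<theta> \<le> 1"
  defines "\<beta> \<equiv> c * sqrt (real n) / \<theta>"
  shows "ennreal (exp (c\<^sup>2 * real n * (real p - 1) / 2))
      * (\<integral>\<^sup>+g. ennreal ((\<Sum>x\<in>Bcube n. exp (\<beta> * tensor_form p n g x)) powr \<theta>) \<partial>gauss_vec (idx_set p n))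
    \<le> (\<integral>\<^sup>+h. ennreal ((\<Sum>x\<in>Bcube n. exp (\<Sum>j<n. \<beta> * sqrt (real p) * x j * h j)) powr \<theta>) \<partial>gauss_vec {..<n})"
proof -
  let ?I = "idx_set p n"
  let ?T = "Bcube n"
  obtain \<iota> where \<iota>: "\<iota> \<notin> ?I"
    using ex_new_if_finite[OF _ finite_idx_set[of p n]] by (auto simp: infinite_UNIV_nat finite_UNIV_fun)
  define \<gamma> where "\<gamma> = \<beta> * sqrt (real p - 1)"
  \<comment> \<open>The index \<open>\<iota>\<close> carries an independent Gaussian of variance \<open>p - 1\<close> that equalises the variances.\<close>
  define a where "a = (\<lambda>x i. if i = \<iota> then \<gamma> else \<beta> * (\<Prod>k<p. x (i k)))"
  define b where "b = (\<lambda>x (j::nat). \<beta> * sqrt (real p) * x j :: real)"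
  have p1: "0 \<le> real p - 1" using p by (cases p) auto
  have covA: "(\<Sum>i\<in>insert \<iota> ?I. a x i * a y i) = \<beta>\<^sup>2 * ((real p - 1) + (\<Sum>i<n. x i * y i) ^ p)" for x y
  proof -
    have "(\<Sum>i\<in>insert \<iota> ?I. a x i * a y i) = \<gamma> * \<gamma> + (\<Sum>i\<in>?I. \<beta>\<^sup>2 * ((\<Prod>k<p. x (i k)) * (\<Prod>k<p. y (i k))))"
      using \<iota> by (simp add: finite_idx_set a_def power2_eq_square mult_ac)
         (intro sum.cong, auto simp: mult_ac)
    then show ?thesis
      using p1 by (simp add: sum_distrib_left[symmetric] sum_idx_set_prod \<gamma>_def power2_eq_square distrib_left mult_ac)
  qed
  have covB: "(\<Sum>j<n. b x j * b y j) = \<beta>\<^sup>2 * (real p * (\<Sum>j<n. x j * y j))" for x y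
    by (simp add: b_def sum_distrib_left power2_eq_square mult_ac)
  have comp: "(\<integral>\<^sup>+g. ennreal ((\<Sum>x\<in>?T. exp (\<Sum>i\<in>insert \<iota> ?I. a x i * g i)) powr \<theta>) \<partial>gauss_vec (insert \<iota> ?I))
    \<le> (\<integral>\<^sup>+h. ennreal ((\<Sum>x\<in>?T. exp (\<Sum>j<n. b x j * h j)) powr \<theta>) \<partial>gauss_vec {..<n})"
  proof (rule gauss_vec_powr_comparison)
    fix x assume "x \<in> ?T"
    then show "(\<Sum>i\<in>insert \<iota> ?I. a x i * a x i) = (\<Sum>j<n. b x j * b x j)"
      unfolding covA covB using sum_Bcube_sq[OF n, of x] by simp
  next
    fix x y :: "nat \<Rightarrow> real"
    show "(\<Sum>j<n. b x j * b y j) \<le> (\<Sum>i\<in>insert \<iota> ?I. a x i * a y i)"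
      unfolding covA covB
      \<comment> \<open>At \<open>t - 1\<close>, where \<open>t\<close> is the inner product, this
        reads \<open>1 + p * (t - 1) \<le> t ^ p\<close>.\<close>
      using Bernoulli_inequality_even[OF p(1), of "(\<Sum>j<n. x j * y j) - 1"]
      by (intro mult_left_mono) (auto simp: algebra_simps)
  qed (use finite_Bcube[OF n] Bcube_nonempty[OF n] th in \<open>simp_all add: finite_idx_set\<close>)
  let ?F = "\<lambda>g. ennreal ((\<Sum>x\<in>?T. exp (\<Sum>i\<in>insert \<iota> ?I. a x i * g i)) powr \<theta>)"
  let ?S = "\<lambda>g. (\<Sum>x\<in>?T. exp (\<beta> * tensor_form p n g x)) powr \<theta>"
  \<comment> \<open>The auxiliary variable multiplies all summands by the same factor, which
    therefore leaves the sum and the power and can be integrated out.\<close>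
  have upd: "?F (g(\<iota> := y)) = ennreal (exp (\<theta> * \<gamma> * y)) * ennreal (?S g)" for g y
  proof -
    have "(\<Sum>i\<in>insert \<iota> ?I. a x i * (g(\<iota> := y)) i) = \<gamma> * y + \<beta> * tensor_form p n g x" for x
    proof -
      have "(\<Sum>i\<in>?I. a x i * (g(\<iota> := y)) i) = (\<Sum>i\<in>?I. \<beta> * ((\<Prod>k<p. x (i k)) * g i))"
        using \<iota> by (intro sum.cong) (auto simp: a_def)
      then show ?thesis
        using \<iota> by (simp add: finite_idx_set tensor_form_def sum_distrib_left a_def)
    qed
    then have "(\<Sum>x\<in>?T. exp (\<Sum>i\<in>insert \<iota> ?I. a x i * (g(\<iota> := y)) i))
        = exp (\<gamma> * y) * (\<Sum>x\<in>?T. exp (\<beta> * tensor_form p n g x))"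
      by (simp add: exp_add sum_distrib_left)
    moreover have "exp (\<gamma> * y) powr \<theta> = exp (\<theta> * \<gamma> * y)"
      by (simp add: powr_def mult_ac)
    ultimately show ?thesis
      by (simp only:) (simp add: powr_mult sum_nonneg ennreal_mult')
  qed
  have mS: "(\<lambda>g. ennreal (?S g)) \<in> borel_measurable (gauss_vec ?I)"
    unfolding tensor_form_def by measurable
  have "(\<integral>\<^sup>+g. ?F g \<partial>gauss_vec (insert \<iota> ?I)) = (\<integral>\<^sup>+g. \<integral>\<^sup>+y. ?F (g(\<iota> := y)) \<partial>gauss \<partial>gauss_vec ?I)"
    unfolding gauss_vec_def
    by (rule gauss_prod.product_nn_integral_insert[OF finite_idx_set \<iota>], fold gauss_vec_def) measurable
  also have "\<dots> = (\<integral>\<^sup>+g. ennreal (exp ((\<theta> * \<gamma>)\<^sup>2 / 2)) * ennreal (?S g) \<partial>gauss_vec ?I)"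
    unfolding upd
    by (intro nn_integral_cong, subst nn_integral_multc)
       (auto intro: borel_measurable_gauss simp: nn_integral_exp_gauss)
  also have "\<dots> = ennreal (exp ((\<theta> * \<gamma>)\<^sup>2 / 2)) * (\<integral>\<^sup>+g. ennreal (?S g) \<partial>gauss_vec ?I)"
    by (rule nn_integral_cmult[OF mS])
  also have "(\<theta> * \<gamma>)\<^sup>2 = c\<^sup>2 * real n * (real p - 1)"
    using th p1 by (simp add: \<gamma>_def \<beta>_def power_mult_distrib)
  finally show ?thesis using comp unfolding b_def by simp
qed

text \<open>Every summand is at most the value for \<open>x\<close> aligned with the signs of
  \<open>h\<close>, and there are at most \<open>2 ^ n\<close> summands. The power
  \<open>\<theta>\<close> cancels the denominator of \<open>\<beta>\<close>, and the bound
  factorises over the coordinates.\<close>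

lemma nn_integral_hypercube_partition_le:
  fixes c \<theta> :: real
  assumes n: "0 < n" and c: "0 \<le> c" and th: "0 < \<theta>"
  defines "\<beta> \<equiv> c * sqrt (real n) / \<theta>"
  shows "(\<integral>\<^sup>+h. ennreal ((\<Sum>x\<in>Bcube n. exp (\<Sum>j<n. \<beta> * sqrt (real p) * x j * h j)) powr \<theta>) \<partial>gauss_vec {..<n})
    \<le> ennreal ((2 ^ n) powr \<theta> * (exp (c\<^sup>2 * real p / 2) * erfc (- (c * sqrt (real p) / sqrt 2))) ^ n)"
proof -
  have \<beta>: "0 \<le> \<beta>" using c th by (simp add: \<beta>_def)
  have bound: "(\<Sum>x\<in>Bcube n. exp (\<Sum>j<n. \<beta> * sqrt (real p) * x j * h j)) powr \<theta>
      \<le> (2 ^ n) powr \<theta> * (\<Prod>j<n. exp (c * sqrt (real p) * \<bar>h j\<bar>))" for h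
  proof -
    let ?H = "\<Sum>j<n. c / \<theta> * sqrt (real p) * \<bar>h j\<bar>"
    have "exp (\<Sum>j<n. \<beta> * sqrt (real p) * x j * h j) \<le> exp ?H" if x: "x \<in> Bcube n" for x
    proof -
      have "\<beta> * sqrt (real p) * x j * h j \<le> c / \<theta> * sqrt (real p) * \<bar>h j\<bar>" if "j < n" for j
      proof -
        have "x j = 1 / sqrt (real n) \<or> x j = - 1 / sqrt (real n)"
          using x that by (auto simp: Bcube_eq_PiE[OF n] PiE_iff)
        then have "\<bar>x j\<bar> = 1 / sqrt (real n)" by auto
        moreover have "x j * h j \<le> \<bar>x j\<bar> * \<bar>h j\<bar>" by (metis abs_ge_self abs_mult)
        ultimately have "\<beta> * sqrt (real p) * (x j * h j) \<le> \<beta> * sqrt (real p) * (1 / sqrt (real n) * \<bar>h j\<bar>)"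
          using \<beta> by (intro mult_left_mono) auto
        also have "\<dots> = c / \<theta> * sqrt (real p) * \<bar>h j\<bar>"
          using n by (simp add: \<beta>_def)
        finally show ?thesis by (simp add: mult.assoc)
      qed
      then show ?thesis by (auto intro: sum_mono)
    qed
    then have "(\<Sum>x\<in>Bcube n. exp (\<Sum>j<n. \<beta> * sqrt (real p) * x j * h j)) \<le> real (card (Bcube n)) * exp ?H"
      by (rule sum_bounded_above)
    also have "\<dots> \<le> 2 ^ n * exp ?H"
    proof (rule mult_right_mono)
      show "real (card (Bcube n)) \<le> 2 ^ n"
        using card_Bcube[OF n] by (metis of_nat_le_iff of_nat_numeral of_nat_power)
    qed simp
    finally have "(\<Sum>x\<in>Bcube n. exp (\<Sum>j<n. \<beta> * sqrt (real p) * x j * h j)) \<le> 2 ^ n * exp ?H" .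
    then have "(\<Sum>x\<in>Bcube n. exp (\<Sum>j<n. \<beta> * sqrt (real p) * x j * h j)) powr \<theta> \<le> (2 ^ n * exp ?H) powr \<theta>"
      using th by (intro powr_mono2) (auto intro: sum_nonneg)
    also have "\<dots> = (2 ^ n) powr \<theta> * exp ?H powr \<theta>"
      by (simp add: powr_mult)
    also have "exp ?H powr \<theta> = exp (\<theta> * ?H)"
      by (simp add: powr_def)
    also have "\<theta> * ?H = (\<Sum>j<n. c * sqrt (real p) * \<bar>h j\<bar>)"
      using th by (simp add: sum_distrib_left)
    finally show ?thesis by (simp add: exp_sum)
  qed
  have "(\<integral>\<^sup>+h. ennreal ((\<Sum>x\<in>Bcube n. exp (\<Sum>j<n. \<beta> * sqrt (real p) * x j * h j)) powr \<theta>) \<partial>gauss_vec {..<n})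
    \<le> (\<integral>\<^sup>+h. ennreal ((2 ^ n) powr \<theta>) * (\<Prod>j<n. ennreal (exp (c * sqrt (real p) * \<bar>h j\<bar>))) \<partial>gauss_vec {..<n})"
    using bound by (intro nn_integral_mono) (simp add: prod_ennreal prod_nonneg flip: ennreal_mult)
  also have "\<dots> = ennreal ((2 ^ n) powr \<theta>) * (\<integral>\<^sup>+h. (\<Prod>j<n. ennreal (exp (c * sqrt (real p) * \<bar>h j\<bar>))) \<partial>gauss_vec {..<n})"
    by (rule nn_integral_cmult) measurable
  also have "(\<integral>\<^sup>+h. (\<Prod>j<n. ennreal (exp (c * sqrt (real p) * \<bar>h j\<bar>))) \<partial>gauss_vec {..<n})
      = (\<Prod>j<n. \<integral>\<^sup>+y. ennreal (exp (c * sqrt (real p) * \<bar>y\<bar>)) \<partial>gauss)"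
    unfolding gauss_vec_def
    by (rule gauss_prod.product_nn_integral_prod) (rule finite_lessThan, rule borel_measurable_gauss, measurable)
  also have "\<dots> = ennreal ((exp (c\<^sup>2 * real p / 2) * erfc (- (c * sqrt (real p) / sqrt 2))) ^ n)"
    unfolding nn_integral_exp_abs_gauss using erfc_pos
    by (simp add: power_mult_distrib ennreal_power less_imp_le)
  finally show ?thesis
    by (simp add: ennreal_mult')
qed

section \<open>Tail bound and exponential rate\<close>

text \<open>Chernoff's bound: on the event some summand of the partition function is at least
  \<open>exp (\<beta> * u * sqrt n)\<close>, so its power \<open>\<theta>\<close> is at least
  \<open>exp (c * u * n)\<close>. The two partition function estimates bound the mean.\<close>

lemma zeta_tail_bound_powr:
  fixes M :: "'a measure" and A :: "(nat \<Rightarrow> nat) \<Rightarrow> 'a \<Rightarrow> real"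
  assumes M: "prob_space M" and p: "even p" "0 < p" and n: "0 < n"
    and indep: "prob_space.indep_vars M (\<lambda>_. borel) A (idx_set p n)"
    and gauss: "\<And>ii. ii \<in> idx_set p n \<Longrightarrow> distributed M lborel (A ii) std_normal_density"
    and c: "0 < c" and th: "0 < \<theta>" "\<theta> \<le> 1"
  shows "measure M {\<omega> \<in> space M. zeta p n (\<lambda>ii. A ii \<omega>) \<ge> u}
    \<le> (2 ^ n) powr \<theta> * exp (real n * (c\<^sup>2 / 2 + ln (erfc (- (c * sqrt (real p) / sqrt 2))) - c * u))"
proof -
  interpret prob_space M by fact
  define \<beta> where "\<beta> = c * sqrt (real n) / \<theta>"
  let ?E = "erfc (- (c * sqrt (real p) / sqrt 2))"
  let ?I = "idx_set p n"
  let ?S = "\<lambda>g. (\<Sum>x\<in>Bcube n. exp (\<beta> * tensor_form p n g x)) powr \<theta>"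
  let ?Z = "{\<omega> \<in> space M. zeta p n (\<lambda>ii. A ii \<omega>) \<ge> u}"
  let ?d = "c\<^sup>2 * real n * (real p - 1) / 2"
  have \<beta>: "0 < \<beta>" using c n th by (simp add: \<beta>_def)
  have "?I \<noteq> {}" using n by (auto simp: idx_set_def PiE_eq_empty_iff)
  then have distr: "distr M (PiM ?I (\<lambda>_. borel)) (\<lambda>\<omega>. \<lambda>ii\<in>?I. A ii \<omega>) = gauss_vec ?I"
    by (rule distr_indep_std_normal[OF M _ indep gauss])
  have rv: "A ii \<in> borel_measurable M" if "ii \<in> ?I" for ii
    using indep that unfolding indep_vars_def2 by auto
  have mS: "(\<lambda>g. ennreal (?S g)) \<in> borel_measurable (PiM ?I (\<lambda>_. borel))"
    unfolding tensor_form_def by measurable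
  have mA: "(\<lambda>\<omega>. \<lambda>ii\<in>?I. A ii \<omega>) \<in> M \<rightarrow>\<^sub>M PiM ?I (\<lambda>_. borel)"
    using rv by (intro measurable_restrict)
  have restrict: "tensor_form p n (\<lambda>ii\<in>?I. A ii \<omega>) x = tensor_form p n (\<lambda>ii. A ii \<omega>) x" for \<omega> x
    unfolding tensor_form_def by (intro sum.cong) auto
  have mSA: "(\<lambda>\<omega>. ennreal (?S (\<lambda>ii. A ii \<omega>))) \<in> borel_measurable M"
    using measurable_compose[OF mA mS] unfolding restrict .
  have law: "(\<integral>\<^sup>+\<omega>. ennreal (?S (\<lambda>ii. A ii \<omega>)) \<partial>M) = (\<integral>\<^sup>+g. ennreal (?S g) \<partial>gauss_vec ?I)"
    using nn_integral_distr[OF mA, unfolded measurable_distr_eq1, OF mS] unfolding distr restrict by (rule sym)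
  have Chernoff: "ennreal (exp (c * u * real n)) * emeasure M ?Z \<le> (\<integral>\<^sup>+\<omega>. ennreal (?S (\<lambda>ii. A ii \<omega>)) \<partial>M)"
  proof (cases "?Z \<in> sets M")
    case True
    have "ennreal (exp (c * u * real n)) * emeasure M ?Z = (\<integral>\<^sup>+\<omega>. ennreal (exp (c * u * real n)) * indicator ?Z \<omega> \<partial>M)"
      using True by (rule nn_integral_cmult_indicator[symmetric])
    also have "\<dots> \<le> (\<integral>\<^sup>+\<omega>. ennreal (?S (\<lambda>ii. A ii \<omega>)) \<partial>M)"
    proof (rule nn_integral_mono)
      fix \<omega>
      show "ennreal (exp (c * u * real n)) * indicator ?Z \<omega> \<le> ennreal (?S (\<lambda>ii. A ii \<omega>))"
      proof (cases "\<omega> \<in> ?Z")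
        case True
        then obtain x where x: "x \<in> Bcube n" "u * sqrt (real n) \<le> tensor_form p n (\<lambda>ii. A ii \<omega>) x"
          using zeta_ge_iff[OF n] by auto
        have "exp (\<beta> * (u * sqrt (real n))) \<le> exp (\<beta> * tensor_form p n (\<lambda>ii. A ii \<omega>) x)"
          using x \<beta> by simp
        also have "\<dots> \<le> (\<Sum>x\<in>Bcube n. exp (\<beta> * tensor_form p n (\<lambda>ii. A ii \<omega>) x))"
          using x finite_Bcube[OF n] by (intro member_le_sum) auto
        finally have "exp (\<beta> * (u * sqrt (real n))) powr \<theta> \<le> ?S (\<lambda>ii. A ii \<omega>)"
          using th by (intro powr_mono2) auto
        also have "exp (\<beta> * (u * sqrt (real n))) powr \<theta> = exp (\<theta> * (\<beta> * (u * sqrt (real n))))"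
          by (simp add: powr_def)
        also have "\<theta> * (\<beta> * (u * sqrt (real n))) = c * u * real n"
          using th by (simp add: \<beta>_def)
        finally show ?thesis using True by (simp add: ennreal_leI)
      qed simp
    qed
    finally show ?thesis .
  next
    case False
    \<comment> \<open>A set that is not measurable has measure 0 by convention.\<close>
    then have "emeasure M ?Z = 0" by (rule emeasure_notin_sets)
    then show ?thesis by (simp only: mult_zero_right zero_le)
  qed
  have "ennreal (exp ?d) * (ennreal (exp (c * u * real n)) * emeasure M ?Z)
      \<le> ennreal (exp ?d) * (\<integral>\<^sup>+g. ennreal (?S g) \<partial>gauss_vec ?I)"
    using Chernoff unfolding law by (rule mult_left_mono) simp
  also have "\<dots> \<le> ennreal ((2 ^ n) powr \<theta> * (exp (c\<^sup>2 * real p / 2) * ?E) ^ n)"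
    using order_trans[OF nn_integral_tensor_partition_le[OF p n th]
        nn_integral_hypercube_partition_le[OF n _ th(1)], of c] c
    unfolding \<beta>_def by simp
  finally have "exp ?d * (exp (c * u * real n) * measure M ?Z) \<le> (2 ^ n) powr \<theta> * (exp (c\<^sup>2 * real p / 2) * ?E) ^ n"
    using erfc_pos[of "- (c * sqrt (real p) / sqrt 2)"]
    by (simp add: emeasure_eq_measure flip: ennreal_mult)
  moreover have "(exp (c\<^sup>2 * real p / 2) * ?E) ^ n = exp (real n * (c\<^sup>2 * real p / 2 + ln ?E))"
    using erfc_pos by (simp add: exp_of_nat_mult exp_add)
  ultimately have "exp (- ?d - c * u * real n) * (exp ?d * (exp (c * u * real n) * measure M ?Z))
      \<le> exp (- ?d - c * u * real n) * ((2 ^ n) powr \<theta> * exp (real n * (c\<^sup>2 * real p / 2 + ln ?E)))"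
    by (intro mult_left_mono) auto
  also have "exp (- ?d - c * u * real n) * (exp ?d * (exp (c * u * real n) * measure M ?Z)) = measure M ?Z"
  proof -
    have "exp (- ?d - c * u * real n) * (exp ?d * exp (c * u * real n)) = 1"
      unfolding exp_add[symmetric] by simp
    then show ?thesis by (simp only: mult.assoc[symmetric])
  qed
  also have "exp (- ?d - c * u * real n) * ((2 ^ n) powr \<theta> * exp (real n * (c\<^sup>2 * real p / 2 + ln ?E)))
      = (2 ^ n) powr \<theta> * exp (- ?d - c * u * real n + real n * (c\<^sup>2 * real p / 2 + ln ?E))"
    by (simp only: exp_add mult.left_commute)
  \<comment> \<open>The auxiliary Gaussian removes \<open>p - 1\<close> of the \<open>p\<close>
    copies of \<open>c\<^sup>2 / 2\<close>.\<close>
  also have "- ?d - c * u * real n + real n * (c\<^sup>2 * real p / 2 + ln ?E) = real n * (c\<^sup>2 / 2 + ln ?E - c * u)"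
    by (simp add: algebra_simps diff_divide_distrib)
  finally show ?thesis .
qed

text \<open>For fixed \<open>n\<close> the probability does not depend on \<open>\<theta>\<close>,
  so letting \<open>\<theta> = 1 / (m + 1)\<close> tend to 0 removes the factor
  \<open>(2 ^ n) powr \<theta>\<close>.\<close>

lemma zeta_tail_bound:
  fixes M :: "'a measure" and A :: "(nat \<Rightarrow> nat) \<Rightarrow> 'a \<Rightarrow> real"
  assumes "prob_space M" "even p" "0 < p" "0 < n"
    and "prob_space.indep_vars M (\<lambda>_. borel) A (idx_set p n)"
    and "\<And>ii. ii \<in> idx_set p n \<Longrightarrow> distributed M lborel (A ii) std_normal_density"
    and "0 < c"
  shows "measure M {\<omega> \<in> space M. zeta p n (\<lambda>ii. A ii \<omega>) \<ge> u}
    \<le> exp (real n * (c\<^sup>2 / 2 + ln (erfc (- (c * sqrt (real p) / sqrt 2))) - c * u))"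
    (is "?P \<le> ?R")
proof -
  have "(\<lambda>m. (2 ^ n) powr (1 / real (Suc m)) * ?R) \<longlonglongrightarrow> (2 ^ n) powr 0 * ?R"
    by (intro tendsto_intros LIMSEQ_Suc[OF lim_1_over_n]) auto
  then have "?P \<le> (2 ^ n) powr 0 * ?R"
    using zeta_tail_bound_powr[OF assms] by (intro LIMSEQ_le_const) auto
  then show ?thesis by simp
qed

text \<open>The rate is stated with an upper limit in the extended reals, which is meaningful
  without convergence; \<open>elog\<close> sends a vanishing probability to minus infinity.\<close>

theorem theorem3:
  fixes M :: "'a measure"
    and A :: "nat \<Rightarrow> (nat \<Rightarrow> nat) \<Rightarrow> 'a \<Rightarrow> real"
    and p :: nat and u c3 :: real
  assumes "prob_space M"
    and "even p" and "p > 0"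
    and indep: "\<And>n. prob_space.indep_vars M (\<lambda>_. borel) (A n) (idx_set p n)"
    and gauss: "\<And>n ii. ii \<in> idx_set p n \<Longrightarrow> distributed M lborel (A n ii) std_normal_density"
    and c3_pos: "c3 > 0"
    and c3_min: "\<forall>c>0. c3\<^sup>2 / 2 + ln (erfc (- (c3 * sqrt p / sqrt 2))) - c3 * u
                   \<le> c\<^sup>2 / 2 + ln (erfc (- (c * sqrt p / sqrt 2))) - c * u"
  shows "1 / erfc (- (c3 * sqrt p / sqrt 2)) = exp (c3\<^sup>2 * p / 2) * (u - c3) * sqrt (pi / (2 * p))
    \<and> - (c3\<^sup>2 / 2) * (real p - 1) - ln (u - c3) - c3 * u - 1/2 * ln (pi / (2 * p))
           = c3\<^sup>2 / 2 + ln (erfc (- (c3 * sqrt p / sqrt 2))) - c3 * u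
    \<and> limsup (\<lambda>n. elog (measure M {\<omega> \<in> space M. zeta p n (\<lambda>ii. A n ii \<omega>) \<ge> u}) / ereal (real n))
           \<le> ereal (c3\<^sup>2 / 2 + ln (erfc (- (c3 * sqrt p / sqrt 2))) - c3 * u)"
proof (intro conjI)
  let ?E = "erfc (- (c3 * sqrt p / sqrt 2))"
  let ?\<phi> = "c3\<^sup>2 / 2 + ln ?E - c3 * u"
  show eq: "1 / ?E = exp (c3\<^sup>2 * p / 2) * (u - c3) * sqrt (pi / (2 * p))"
    unfolding of_nat_mult of_nat_numeral
    by (rule erfc_minimizer_equation[OF c3_pos _ c3_min]) (use \<open>p > 0\<close> in simp)
  have E: "0 < ?E" by (rule erfc_pos)
  have s: "0 < sqrt (pi / (2 * p))" using \<open>p > 0\<close> by simp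
  have "0 < exp (c3\<^sup>2 * p / 2) * (u - c3) * sqrt (pi / (2 * p))"
    unfolding eq[symmetric] using E by simp
  \<comment> \<open>Positivity is read off from the stationarity equation, whose left side is
    positive; it licenses the logarithm of \<open>u - c3\<close>.\<close>
  then have uc: "0 < u - c3" using s by (simp add: zero_less_mult_iff)
  have "- ln ?E = ln (1 / ?E)" using E by (simp add: ln_div)
  also have "\<dots> = c3\<^sup>2 * p / 2 + ln (u - c3) + ln (sqrt (pi / (2 * p)))"
    unfolding eq using ln_mult[of "exp (c3\<^sup>2 * p / 2) * (u - c3)" "sqrt (pi / (2 * p))"]
      ln_mult[of "exp (c3\<^sup>2 * p / 2)" "u - c3"] uc s \<open>p > 0\<close> by simp
  also have "ln (sqrt (pi / (2 * p))) = 1/2 * ln (pi / (2 * p))"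
    using \<open>p > 0\<close> by (simp add: ln_sqrt)
  finally show "- (c3\<^sup>2 / 2) * (real p - 1) - ln (u - c3) - c3 * u - 1/2 * ln (pi / (2 * p)) = ?\<phi>"
    by (simp add: algebra_simps diff_divide_distrib)
  let ?P = "\<lambda>n. measure M {\<omega> \<in> space M. zeta p n (\<lambda>ii. A n ii \<omega>) \<ge> u}"
  have "elog (?P n) / ereal (real n) \<le> ereal ?\<phi>" if n: "0 < n" for n
  proof (cases "0 < ?P n")
    case True
    have "ln (?P n) \<le> ln (exp (real n * ?\<phi>))"
      using True zeta_tail_bound[OF assms(1-3) n indep gauss c3_pos] by (subst ln_le_cancel_iff) auto
    then have "ln (?P n) / real n \<le> ?\<phi>" using n by (simp add: field_simps)
    then show ?thesis using True n by (simp add: elog_def)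
  next
    case False
    then show ?thesis using n by (simp add: elog_def divide_ereal_def)
  qed
  then show "limsup (\<lambda>n. elog (?P n) / ereal (real n)) \<le> ereal ?\<phi>"
    \<comment> \<open>The bound holds for each \<open>n \<ge> 1\<close>, not only asymptotically;
      starting at 1 leaves out the division by 0.\<close>
    by (intro Limsup_bounded eventually_sequentiallyI[of 1]) auto
qed

end
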